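(* Let $X$ be a metric space and $\psi : X \to X$ a continuous map. Suppose $$X = \bigcup_{l=0}^\infty C_l,$$ where each $C_l$ is a $\psi$-invariant compact subset and $C_l \subset C_{l+1}$ for each $l$. Then $$\sup_{\mu} h_\mu(\psi) = \lim_{l\to\infty} h\left(\psi|_{C_l}\right),$$ where the supremum is taken over all $\psi$-invariant Radon probability measures $\mu$ on $X$.
   Context: A subset $C$ is $\psi$-invariant if $\psi(C) \subset C$. A measure $\mu$ is $\psi$-invariant if $\mu(\psi^{-1}(A)) = \mu(A)$ for all Borel sets $A$. Kolmogorov–Sinai entropy: for a finite measurable partition $\mathcal{P}$, $H_\mu(\mathcal{P}) = \sum_{P\in\mathcal{P}} \mu(P)\log\frac{1}{\mu(P)}$; $\mathcal{P}^j$ is the partition into the sets $P_0\cap\psi^{-1}(P_1)\cap\cdots\cap\psi^{-(j-1)}(P_{j-1})$ with $P_i\in\mathcal{P}$; $h_\mu(\psi,\mathcal{P}) = \lim_{j\to\infty}\frac{1}{j}H_\mu(\mathcal{P}^j)$; and $h_\mu(\psi)=\sup_{\mathcal{P}} h_\mu(\psi,\mathcal{P})$ over all finite measurable partitions. Topological entropy: for a continuous map $\psi$ of a topological space, an open cover $\mathcal{A}$ is admissible if at least one of its elements has compact complement (on a compact space every nonempty open cover by open sets is admissible). $N(\mathcal{A})$ is the least cardinality of a subcover; $\mathcal{A}^j$ consists of the sets $A_0\cap\psi^{-1}(A_1)\cap\cdots\cap\psi^{-(j-1)}(A_{j-1})$ with $A_i\in\mathcal{A}$; $h(\psi,\mathcal{A})=\lim_{j\to\infty}\frac{1}{j}\log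 N(\mathcal{A}^j)$; and $h(\psi)=\sup_{\mathcal{A}}h(\psi,\mathcal{A})$ over admissible open covers. Entropies take values in $[0,\infty]$. $\psi|_{C_l} : C_l \to C_l$ is the restriction. *)

theory Defs
  imports "HOL-Probability.Probability_Measure"
begin

text \<open>The family written \<open>\<U>\<^sup>j\<close> for a partition or a cover \<open>\<U>\<close> of the carrier \<open>S\<close>.
  A partition may acquire the empty set as a further member; it contributes 0 to the entropy.\<close>

definition iterated_join :: "'a set \<Rightarrow> ('a \<Rightarrow> 'a) \<Rightarrow> 'a set set \<Rightarrow> nat \<Rightarrow> 'a set set" where
  "iterated_join S f \<U> j =
     {S \<inter> (\<Inter>i<j. (f ^^ i) -` U i) | U :: nat \<Rightarrow> 'a set. \<forall>i<j. U i \<in> \<U>}"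


subsection \<open>Kolmogorov--Sinai entropy\<close>

definition invariant_measure :: "'a measure \<Rightarrow> ('a \<Rightarrow> 'a) \<Rightarrow> bool" where
  "invariant_measure M f \<longleftrightarrow>
     (\<forall>A\<in>sets M. emeasure M (f -` A \<inter> space M) = emeasure M A)"

definition radon_measure :: "'a::t2_space measure \<Rightarrow> bool" where
  "radon_measure M \<longleftrightarrow>
     sets M = sets borel \<and>
     (\<forall>x. \<exists>U. open U \<and> x \<in> U \<and> emeasure M U < \<infinity>) \<and>
     (\<forall>A\<in>sets M. emeasure M A = (SUP K\<in>{K. compact K \<and> K \<subseteq> A}. emeasure M K))"

definition finite_measurable_partition :: "'a measure \<Rightarrow> 'a set set \<Rightarrow> bool" where
  "finite_measurable_partition M \<P> \<longleftrightarrow>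
     finite \<P> \<and> \<P> \<subseteq> sets M \<and> partition_on (space M) \<P>"

text \<open>The convention \<open>0 log (1/0) = 0\<close> holds because \<open>ln\<close> is multiplied by \<open>0\<close>.\<close>

definition partition_entropy :: "'a measure \<Rightarrow> 'a set set \<Rightarrow> real" where
  "partition_entropy M \<P> = (\<Sum>P\<in>\<P>. measure M P * ln (1 / measure M P))"

definition KS_entropy_partition :: "'a measure \<Rightarrow> ('a \<Rightarrow> 'a) \<Rightarrow> 'a set set \<Rightarrow> real" where
  "KS_entropy_partition M f \<P> =
     lim (\<lambda>j. 1 / real j * partition_entropy M (iterated_join (space M) f \<P> j))"

definition KS_entropy :: "'a measure \<Rightarrow> ('a \<Rightarrow> 'a) \<Rightarrow> ennreal" where
  "KS_entropy M f =
     (SUP \<P>\<in>{\<P>. finite_measurable_partition M \<P>}. ennreal (KS_entropy_partition M f \<P>))"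


subsection \<open>Topological entropy\<close>

definition admissible_cover :: "'a topology \<Rightarrow> 'a set set \<Rightarrow> bool" where
  "admissible_cover X \<A> \<longleftrightarrow>
     (\<forall>A\<in>\<A>. openin X A) \<and> \<Union>\<A> = topspace X \<and>
     (\<exists>A\<in>\<A>. compactin X (topspace X - A))"

text \<open>An admissible cover \<open>\<A>\<close> has a finite subcover, hence so does each \<open>\<A>\<^sup>j\<close>; restricting to
  finite subcovers therefore loses nothing, and it excludes infinite ones, whose \<open>card\<close> is \<open>0\<close>.\<close>

definition cover_number :: "'a set \<Rightarrow> 'a set set \<Rightarrow> nat" where
  "cover_number S \<A> = (LEAST n. \<exists>\<B>\<subseteq>\<A>. finite \<B> \<and> \<Union>\<B> = S \<and> card \<B> = n)"

definition topological_entropy_cover :: "'a topology \<Rightarrow> ('a \<Rightarrow> 'a) \<Rightarrow> 'a set set \<Rightarrow> real" where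
  "topological_entropy_cover X f \<A> =
     lim (\<lambda>j. 1 / real j * ln (real (cover_number (topspace X) (iterated_join (topspace X) f \<A> j))))"

text \<open>The empty space (where the cover number is \<open>0\<close>) gets entropy \<open>0\<close>, since \<open>ln 0 = 0\<close>.\<close>

definition topological_entropy :: "'a topology \<Rightarrow> ('a \<Rightarrow> 'a) \<Rightarrow> ennreal" where
  "topological_entropy X f =
     (SUP \<A>\<in>{\<A>. admissible_cover X \<A>}. ennreal (topological_entropy_cover X f \<A>))"

end

theory Submission
  imports Defs
begin

text \<open>For an invariant Radon measure \<open>\<mu>\<close> and a finite partition \<open>\<P>\<close>, inner regularity gives compact
  subsets \<open>K\<^sub>v\<close> of the atoms \<open>v\<close> of \<open>\<P>\<^sup>k\<close> that together have almost full measure and are contained in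
  \<open>C\<^sub>l\<close> for every large \<open>l\<close>. Cover \<open>C\<^sub>l\<close> by the sets \<open>C\<^sub>l - (\<Union>w\<noteq>v. K\<^sub>w)\<close>: each of them meets only \<open>K\<^sub>v\<close>
  and the remainder outside all \<open>K\<^sub>w\<close>, and almost no orbit enters \<open>C\<^sub>l\<close> from outside. Hence the entropy
  of \<open>\<psi>\<^sup>k\<close> for \<open>\<P>\<^sup>k\<close> is at most \<open>k\<close> times the topological entropy on \<open>C\<^sub>l\<close> plus a constant, which
  disappears on dividing by \<open>k\<close>. As this works for all large \<open>l\<close>, monotonicity in \<open>l\<close> is never needed.

  Conversely, for a cover of \<open>C\<^sub>l\<close> one follows Misiurewicz and averages the counting measures of
  maximal separated sets along orbits. A setwise cluster point exists by Tychonoff but is only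
  finitely additive; on the algebra of sets that can be squeezed between a closed and an open
  set of nearly equal content it agrees with a Radon measure, and a fine partition can be chosen
  inside that algebra.\<close>

subsection \<open>Subadditive sequences and entropy of finite observables\<close>

text \<open>The cells of a partition are in general neither open nor closed, whereas covers are
  open. The sets \<open>K v\<close> repair this: at each observed time a member of the cover leaves
  only the choice between one \<open>K v\<close> and the unlabelled remainder. So each block of
  \<open>k\<close> steps costs a factor 2 whatever the size of the partition, plus the conditional
  entropy, at most 2, of the labels lost on the remainder. With ln 2 rounded up to 1 this is the
  constant 3, paid once per block.

  In the converse direction, setwise instead of weak convergence gives invariance and convergence of
  the entropy of every finite partition, with no condition on boundaries. The price is countable
  additivity, and the boundary condition returns as the demand that the cells lie in the algebra on
  which the limit is a measure. Entropy is therefore developed for finitely additive contents, so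
  that the same inequalities serve Borel measures, counting measures and their limits. The orbit
  length tends to infinity first, with the block length fixed; only then does the block length
  grow.\<close>

lemma fekete:
  fixes a :: "nat \<Rightarrow> real"
  assumes nonneg: "\<And>n. 0 \<le> a n" and subadd: "\<And>m n. a (m + n) \<le> a m + a n"
  shows "(\<lambda>n. a n / n) \<longlonglongrightarrow> (INF n\<in>{1..}. a n / n)"
proof -
  let ?L = "INF n\<in>{1..}. a n / n"
  have bdd: "bdd_below ((\<lambda>n. a n / n) ` {1..})"
    by (rule bdd_belowI[of _ 0]) (auto simp: nonneg)
  have mult: "a (k * q + r) \<le> k * a q + a r" for k q r
  proof (induction k)
    case (Suc k)
    have "a (Suc k * q + r) \<le> a q + a (k * q + r)"
      using subadd[of q "k * q + r"] by (simp add: algebra_simps)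
    with Suc show ?case by (simp add: algebra_simps)
  qed simp
  show ?thesis
  proof (rule order_tendstoI)
    fix l assume "l < ?L"
    moreover have "?L \<le> a n / n" if "n \<ge> 1" for n
      using that bdd by (intro cINF_lower) auto
    ultimately show "\<forall>\<^sub>F n in sequentially. l < a n / n"
      by (intro eventually_sequentiallyI[of 1]) (meson less_le_trans)
  next
    fix u assume "?L < u"
    then obtain q where q: "q \<ge> 1" "a q / q < u"
      using bdd by (subst (asm) cINF_less_iff) auto
    \<comment> \<open>Division with remainder leaves a term \<open>a (n mod q)\<close>; by
      nonnegativity \<open>B\<close> bounds all of these at once, and \<open>B / n\<close> vanishes
      in the limit.\<close>
    define B where "B = (\<Sum>r<q. a r)"
    have "a n / n \<le> a q / q + B / n" if "n \<ge> 1" for n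
    proof -
      have "a (n mod q) \<le> B"
        unfolding B_def using q nonneg by (intro member_le_sum) auto
      then have "a n \<le> (n div q) * a q + B"
        using mult[of "n div q" q "n mod q"] by simp
      also have "real (n div q) * a q \<le> (n / q) * a q"
        using nonneg of_nat_div_le_of_nat by (intro mult_right_mono) auto
      finally show ?thesis using that q by (simp add: field_simps)
    qed
    then have le: "\<forall>\<^sub>F n in sequentially. a n / n \<le> a q / q + B / n"
      by (intro eventually_sequentiallyI[of 1])
    have "(\<lambda>n. a q / q + B / n) \<longlonglongrightarrow> a q / q + 0"
      by (intro tendsto_intros lim_const_over_n)
    then have "\<forall>\<^sub>F n in sequentially. a q / q + B / n < u"
      using q by (intro order_tendstoD) auto
    with le show "\<forall>\<^sub>F n in sequentially. a n / n < u"
      by eventually_elim simp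
  qed
qed

text \<open>Both entropies are defined through \<open>lim\<close>, which carries information only
  once convergence is known. The term at n = 0 is harmless, as 1 / 0 = 0.\<close>

corollary fekete_lim:
  fixes a :: "nat \<Rightarrow> real"
  assumes "\<And>n. 0 \<le> a n" and "\<And>m n. a (m + n) \<le> a m + a n"
  shows "(\<lambda>n. 1 / n * a n) \<longlonglongrightarrow> lim (\<lambda>n. 1 / n * a n)"
    and "n \<ge> 1 \<Longrightarrow> n * lim (\<lambda>n. 1 / n * a n) \<le> a n"
proof -
  have *: "(\<lambda>n. 1 / n * a n) \<longlonglongrightarrow> (INF n\<in>{1..}. a n / n)"
    using fekete[of a] assms by simp
  then have L: "lim (\<lambda>n. 1 / n * a n) = (INF n\<in>{1..}. a n / n)"
    by (rule limI)
  show "(\<lambda>n. 1 / n * a n) \<longlonglongrightarrow> lim (\<lambda>n. 1 / n * a n)"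
    using * L by simp
  assume n: "n \<ge> 1"
  have "bdd_below ((\<lambda>n. a n / n) ` {1..})"
    by (rule bdd_belowI[of _ 0]) (auto simp: assms)
  then have "(INF n\<in>{1..}. a n / n) \<le> a n / n"
    using n by (intro cINF_lower) auto
  then show "n * lim (\<lambda>n. 1 / n * a n) \<le> a n"
    using n L by (simp add: field_simps)
qed

section \<open>Inequalities for the summand of Shannon entropy\<close>

definition eta :: "real \<Rightarrow> real" where
  "eta p = p * ln (1 / p)"

lemma eta_simps [simp]: "eta 0 = 0" "eta 1 = 0"
  by (auto simp: eta_def)

lemma eta_nonneg: "0 \<le> p \<Longrightarrow> p \<le> 1 \<Longrightarrow> 0 \<le> eta p"
  by (cases "p = 0") (auto simp: eta_def)

lemma eta_eq: "0 \<le> p \<Longrightarrow> eta p = - (p * ln p)"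
  by (cases "p = 0") (auto simp: eta_def ln_div)

text \<open>This is ln t \<le> t - 1 at t = 1 / sqrt p; the factor 2 comes from ln (1 / p) = 2 ln (1
  / sqrt p). A bound free of logarithms gives continuity at 0 and later an explicit choice of a
  small content.\<close>

lemma eta_le_sqrt:
  assumes "0 \<le> p"
  shows "eta p \<le> 2 * sqrt p"
proof (cases "p = 0")
  case False
  with assms have p: "p > 0" by simp
  have "ln (1 / sqrt p) \<le> 1 / sqrt p - 1"
    using p by (intro ln_le_minus_one) auto
  moreover have "ln (1 / p) = 2 * ln (1 / sqrt p)"
    using p by (simp add: ln_div ln_sqrt)
  ultimately have "eta p \<le> p * (2 * (1 / sqrt p))"
    unfolding eta_def using p by (intro mult_left_mono) auto
  also have "\<dots> = 2 * (p / sqrt p)" by simp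
  also have "\<dots> = 2 * sqrt p"
    using p by (simp only: real_div_sqrt)
  finally show ?thesis .
qed simp

text \<open>Away from 0 this is continuity of the logarithm; at 0 the square root bound
  squeezes.\<close>

lemma tendsto_eta:
  assumes "(f \<longlongrightarrow> p) G" and "\<And>n. 0 \<le> f n" and "\<And>n. f n \<le> 1" and "0 \<le> p"
  shows "((\<lambda>n. eta (f n)) \<longlongrightarrow> eta p) G"
proof (cases "p = 0")
  case True
  have "((\<lambda>n. 2 * sqrt (f n)) \<longlongrightarrow> 2 * sqrt p) G"
    by (intro tendsto_intros assms)
  then have *: "((\<lambda>n. 2 * sqrt (f n)) \<longlongrightarrow> 0) G"
    using True by simp
  have "((\<lambda>n. eta (f n)) \<longlongrightarrow> 0) G"
    by (rule tendsto_sandwich[OF _ _ tendsto_const *])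
       (auto intro!: always_eventually eta_nonneg eta_le_sqrt assms)
  then show ?thesis using True by simp
next
  case False
  then show ?thesis
    unfolding eta_def using assms by (intro tendsto_intros) auto
qed

text \<open>The right side is the tangent to the concave function \<open>eta\<close> at
  \<open>q\<close>. Summed over suitable \<open>q\<close> of the same total mass as
  \<open>p\<close>, the corrections \<open>q - p\<close> cancel; Jensen's inequality, subadditivity
  of entropy and the bound by ln of a cardinality all arise in this way.\<close>

lemma eta_gibbs:
  assumes "0 \<le> p" "0 < q"
  shows "eta p \<le> - p * ln q + (q - p)"
proof (cases "p = 0")
  case False
  with assms have p: "p > 0" by simp
  have "ln (q / p) \<le> q / p - 1"
    using p assms by (intro ln_le_minus_one) auto
  then have "p * ln (q / p) \<le> p * (q / p - 1)"
    using p by (intro mult_left_mono) auto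
  also have "\<dots> = q - p" using p by (simp add: field_simps)
  finally show ?thesis
    using p assms by (simp add: eta_eq ln_div algebra_simps)
qed (use assms in simp)

text \<open>Each \<open>p i\<close> is at most the sum, so replacing its logarithm by that of the
  sum lowers the term. This is why merging cells lowers entropy.\<close>

lemma eta_sum_le:
  assumes "finite A" "\<And>i. i \<in> A \<Longrightarrow> 0 \<le> p i"
  shows "eta (\<Sum>i\<in>A. p i) \<le> (\<Sum>i\<in>A. eta (p i))"
proof -
  let ?s = "\<Sum>i\<in>A. p i"
  have "- (p i * ln ?s) \<le> eta (p i)" if "i \<in> A" for i
  proof (cases "p i = 0")
    case False
    with that assms have "p i > 0" by force
    moreover have "p i \<le> ?s"
      using that assms by (intro member_le_sum) auto
    ultimately show ?thesis by (simp add: eta_eq)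
  qed simp
  then have "(\<Sum>i\<in>A. - (p i * ln ?s)) \<le> (\<Sum>i\<in>A. eta (p i))"
    by (rule sum_mono)
  moreover have "eta ?s = (\<Sum>i\<in>A. - (p i * ln ?s))"
    using assms by (simp add: eta_eq sum_nonneg sum_negf sum_distrib_right)
  ultimately show ?thesis by simp
qed

text \<open>Jensen's inequality by the tangent at the mean. A mean of 0 admits no tangent and is
  treated apart; then all \<open>p i\<close> vanish.\<close>

lemma eta_concave:
  assumes "n > (0::nat)" "\<And>i. i < n \<Longrightarrow> 0 \<le> p i"
  shows "(\<Sum>i<n. eta (p i)) \<le> n * eta (1 / n * (\<Sum>i<n. p i))"
proof (cases "(\<Sum>i<n. p i) = 0")
  case True
  then have "p i = 0" if "i < n" for i
    using that assms by (subst (asm) sum_nonneg_eq_0_iff) auto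
  then show ?thesis by simp
next
  case False
  let ?q = "1 / n * (\<Sum>i<n. p i)"
  have "(\<Sum>i<n. p i) > 0"
    using False sum_nonneg[of "{..<n}" p] assms by fastforce
  then have q: "?q > 0" using assms by simp
  have "(\<Sum>i<n. eta (p i)) \<le> (\<Sum>i<n. - p i * ln ?q + (?q - p i))"
    by (intro sum_mono eta_gibbs) (use assms q in auto)
  also have "\<dots> = - (\<Sum>i<n. p i) * ln ?q + (n * ?q - (\<Sum>i<n. p i))"
    by (simp add: sum.distrib sum_subtractf sum_distrib_right sum_negf)
  also have "\<dots> = n * eta ?q"
    using assms q by (subst eta_eq) auto
  finally show ?thesis .
qed

text \<open>The unnormalised form of subadditivity of entropy: \<open>p\<close> need not have total mass 1, so that
  conditioning on a further variable amounts to summing over its values.\<close>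

lemma eta_matrix:
  fixes p :: "'a \<Rightarrow> 'b \<Rightarrow> real"
  assumes "finite A" "finite B" and nonneg: "\<And>x y. 0 \<le> p x y"
  shows "(\<Sum>x\<in>A. \<Sum>y\<in>B. eta (p x y)) + eta (\<Sum>x\<in>A. \<Sum>y\<in>B. p x y)
    \<le> (\<Sum>x\<in>A. eta (\<Sum>y\<in>B. p x y)) + (\<Sum>y\<in>B. eta (\<Sum>x\<in>A. p x y))"
proof -
  define r where "r x = (\<Sum>y\<in>B. p x y)" for x
  define s where "s y = (\<Sum>x\<in>A. p x y)" for y
  define P where "P = (\<Sum>x\<in>A. r x)"
  have P': "P = (\<Sum>y\<in>B. s y)"
    unfolding P_def r_def s_def by (rule sum.swap)
  have r0: "0 \<le> r x" and s0: "0 \<le> s y" for x y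
    by (auto simp: r_def s_def nonneg sum_nonneg)
  have P0: "0 \<le> P" by (auto simp: P_def r0 sum_nonneg)
  have le_r: "p x y \<le> r x" if "y \<in> B" for x y
    unfolding r_def using that assms by (intro member_le_sum) auto
  have le_s: "p x y \<le> s y" if "x \<in> A" for x y
    unfolding s_def using that assms by (intro member_le_sum) auto
  have le_P: "r x \<le> P" if "x \<in> A" for x
    unfolding P_def using that assms r0 by (intro member_le_sum) auto
  \<comment> \<open>The tangent is taken at the product of the marginals, rescaled by
    \<open>P\<close>, so that these weights sum to \<open>P\<close> like the
    \<open>p x y\<close>.\<close>
  have key: "eta (p x y) \<le> - p x y * ln (r x) - p x y * ln (s y) + p x y * ln P + (r x * s y / P - p x y)"
    if "x \<in> A" "y \<in> B" for x y
  proof (cases "p x y = 0")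
    case True
    then show ?thesis using r0 s0 P0 by simp
  next
    case False
    then have "p x y > 0" using nonneg by (simp add: order_less_le)
    then have pos: "r x > 0" "s y > 0" "P > 0"
      using le_r le_s le_P that by (smt (verit))+
    have "eta (p x y) \<le> - p x y * ln (r x * s y / P) + (r x * s y / P - p x y)"
      using pos by (intro eta_gibbs nonneg) auto
    also have "ln (r x * s y / P) = ln (r x) + ln (s y) - ln P"
      using pos by (simp add: ln_div ln_mult)
    finally show ?thesis by (simp add: algebra_simps)
  qed
  have "(\<Sum>x\<in>A. \<Sum>y\<in>B. eta (p x y))
    \<le> (\<Sum>x\<in>A. \<Sum>y\<in>B. - p x y * ln (r x) - p x y * ln (s y) + p x y * ln P + (r x * s y / P - p x y))"
    by (intro sum_mono key)
  also have "\<dots> = - (\<Sum>x\<in>A. \<Sum>y\<in>B. p x y * ln (r x)) - (\<Sum>x\<in>A. \<Sum>y\<in>B. p x y * ln (s y))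
      + (\<Sum>x\<in>A. \<Sum>y\<in>B. p x y * ln P) + ((\<Sum>x\<in>A. \<Sum>y\<in>B. r x * s y / P) - (\<Sum>x\<in>A. \<Sum>y\<in>B. p x y))"
    by (simp add: sum.distrib sum_subtractf sum_negf)
  also have "(\<Sum>x\<in>A. \<Sum>y\<in>B. p x y * ln (r x)) = - (\<Sum>x\<in>A. eta (r x))"
    by (simp add: eta_eq r0 sum_negf flip: sum_distrib_right r_def)
  also have "(\<Sum>x\<in>A. \<Sum>y\<in>B. p x y * ln (s y)) = - (\<Sum>y\<in>B. eta (s y))"
    by (subst sum.swap) (simp add: eta_eq s0 sum_negf flip: sum_distrib_right s_def)
  also have "(\<Sum>x\<in>A. \<Sum>y\<in>B. p x y * ln P) = - eta P"
    using P0 by (simp add: eta_eq flip: sum_distrib_right r_def P_def)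
  also have "(\<Sum>x\<in>A. \<Sum>y\<in>B. r x * s y / P) = P * P / P"
    unfolding sum_divide_distrib[symmetric] sum_product[symmetric]
    by (simp flip: P_def P')
  also have "(\<Sum>x\<in>A. \<Sum>y\<in>B. p x y) = P"
    by (simp add: P_def r_def)
  finally show ?thesis
    by (simp add: P_def flip: r_def s_def)
qed

section \<open>Entropy of finite observables under a finitely additive probability\<close>

definition fibre_entropy :: "('a set \<Rightarrow> real) \<Rightarrow> ('a \<Rightarrow> 'b) \<Rightarrow> real" where
  "fibre_entropy m X = (\<Sum>v\<in>range X. eta (m (X -` {v})))"

text \<open>Labels that never occur have an empty fibre and contribute 0. Thus pairs can be summed
  over a product of ranges, even where not all combinations occur.\<close>

lemma fibre_entropy_superset:
  assumes "finite V" "range X \<subseteq> V" "m {} = 0"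
  shows "fibre_entropy m X = (\<Sum>v\<in>V. eta (m (X -` {v})))"
proof -
  have "X -` {v} = {}" if "v \<notin> range X" for v
    using that by auto
  then show ?thesis
    unfolding fibre_entropy_def using assms
    by (intro sum.mono_neutral_left) auto
qed

text \<open>A finite partition is treated as the fibres of a function, so that joins are pairs of
  functions and coarsening is composition. Only finite additivity is assumed, since a setwise limit
  of orbit averages need not have more; the algebra \<open>F\<close> may be a Borel algebra or the
  power set.\<close>

locale prob_content = algebra "UNIV :: 'a set" F for F :: "'a set set" +
  fixes m :: "'a set \<Rightarrow> real"
  assumes nonneg: "A \<in> F \<Longrightarrow> 0 \<le> m A"
    and total: "m UNIV = 1"
    and additive: "A \<in> F \<Longrightarrow> B \<in> F \<Longrightarrow> A \<inter> B = {} \<Longrightarrow> m (A \<union> B) = m A + m B"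
begin

lemma content_empty [simp]: "m {} = 0"
  using additive[of "{}" "{}"] by simp

lemma content_UN:
  assumes "finite I" "\<And>i. i \<in> I \<Longrightarrow> A i \<in> F" "disjoint_family_on A I"
  shows "m (\<Union>i\<in>I. A i) = (\<Sum>i\<in>I. m (A i))"
  using assms
proof (induction rule: finite_induct)
  case (insert i I)
  have "m (A i \<union> (\<Union>i\<in>I. A i)) = m (A i) + m (\<Union>i\<in>I. A i)"
  proof (rule additive)
    show "A i \<inter> (\<Union>i\<in>I. A i) = {}"
      using insert.prems(2) insert.hyps(2) unfolding disjoint_family_on_def by fastforce
  qed (use insert in auto)
  moreover have "disjoint_family_on A I"
    using insert.prems(2) by (rule disjoint_family_on_mono[rotated]) auto
  ultimately show ?case
    using insert by simp
qed simp

lemma content_Diff: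
  assumes "A \<in> F" "B \<in> F" "B \<subseteq> A"
  shows "m (A - B) = m A - m B"
proof -
  have "m (B \<union> (A - B)) = m B + m (A - B)"
    using assms by (intro additive) auto
  moreover have "B \<union> (A - B) = A" using assms by auto
  ultimately show ?thesis by simp
qed

lemma content_mono:
  assumes "A \<in> F" "B \<in> F" "B \<subseteq> A"
  shows "m B \<le> m A"
proof -
  have "0 \<le> m (A - B)" using assms by (intro nonneg) auto
  then show ?thesis using content_Diff[OF assms] by simp
qed

lemma content_le_1: "A \<in> F \<Longrightarrow> m A \<le> 1"
  using content_mono[of UNIV A] total by simp

lemma content_Un_le:
  assumes "A \<in> F" "B \<in> F"
  shows "m (A \<union> B) \<le> m A + m B"
proof -
  have "m (A \<union> (B - A)) = m A + m (B - A)"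
    using assms by (intro additive) auto
  moreover have "m (B - A) \<le> m B"
    using assms by (intro content_mono) auto
  ultimately show ?thesis by simp
qed

lemma content_UN_le:
  assumes "finite I" "\<And>i. i \<in> I \<Longrightarrow> A i \<in> F"
  shows "m (\<Union>i\<in>I. A i) \<le> (\<Sum>i\<in>I. m (A i))"
  using assms
proof (induction rule: finite_induct)
  case (insert i I)
  have "m (A i \<union> (\<Union>i\<in>I. A i)) \<le> m (A i) + m (\<Union>i\<in>I. A i)"
    using insert by (intro content_Un_le) auto
  with insert show ?case by simp
qed simp

definition observable :: "('a \<Rightarrow> 'b) \<Rightarrow> bool" where
  "observable X \<longleftrightarrow> finite (range X) \<and> (\<forall>v. X -` {v} \<in> F)"

lemma observable_finite: "observable X \<Longrightarrow> finite (range X)"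
  by (simp add: observable_def)

lemma observable_fibre [intro]: "observable X \<Longrightarrow> X -` {v} \<in> F"
  by (simp add: observable_def)

lemma observable_vimage:
  assumes "observable X"
  shows "X -` V \<in> F"
proof -
  have "X -` V = (\<Union>v\<in>range X \<inter> V. X -` {v})" by auto
  also have "\<dots> \<in> F"
    using assms by (intro finite_UN) (auto simp: observable_def)
  finally show ?thesis .
qed

lemma observable_comp:
  assumes "observable X" "\<And>\<omega>. Y \<omega> = g (X \<omega>)"
  shows "observable Y"
proof -
  have Y: "Y = g \<circ> X" using assms(2) by (simp add: fun_eq_iff)
  have "Y -` {v} = X -` (g -` {v})" for v by (auto simp: Y)
  moreover have "finite (range Y)"
    unfolding Y image_comp[symmetric] by (intro finite_imageI observable_finite assms)
  ultimately show ?thesis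
    using observable_vimage[OF assms(1)] by (simp add: observable_def)
qed

lemma observable_Pair:
  assumes "observable X" "observable Y"
  shows "observable (\<lambda>\<omega>. (X \<omega>, Y \<omega>))"
proof -
  have "(\<lambda>\<omega>. (X \<omega>, Y \<omega>)) -` {v} = X -` {fst v} \<inter> Y -` {snd v}" for v by auto
  moreover have "finite (range (\<lambda>\<omega>. (X \<omega>, Y \<omega>)))"
    by (rule finite_subset[of _ "range X \<times> range Y"])
       (use assms in \<open>auto simp: observable_def\<close>)
  ultimately show ?thesis
    using assms by (auto simp: observable_def)
qed

lemma content_sum_fibres:
  assumes "observable X" "A \<in> F"
  shows "m A = (\<Sum>v\<in>range X. m (X -` {v} \<inter> A))"
proof -
  have "m (\<Union>v\<in>range X. X -` {v} \<inter> A) = (\<Sum>v\<in>range X. m (X -` {v} \<inter> A))"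
    using assms by (intro content_UN) (auto simp: observable_def disjoint_family_on_def)
  moreover have "(\<Union>v\<in>range X. X -` {v} \<inter> A) = A" by auto
  ultimately show ?thesis by simp
qed

lemma fibre_entropy_nonneg: "observable X \<Longrightarrow> 0 \<le> fibre_entropy m X"
  unfolding fibre_entropy_def
  by (intro sum_nonneg eta_nonneg nonneg content_le_1) auto

text \<open>Each fibre of \<open>Y\<close> is a finite union of fibres of \<open>X\<close>, so
  \<open>eta_sum_le\<close> applies. With a bijective \<open>g\<close> this also serves to reorder
  or regroup tuples.\<close>

lemma fibre_entropy_mono:
  assumes "observable X" "\<And>\<omega>. Y \<omega> = g (X \<omega>)"
  shows "fibre_entropy m Y \<le> fibre_entropy m X"
proof -
  let ?p = "\<lambda>v. m (X -` {v})"
  have Y: "Y = g \<circ> X" using assms(2) by (simp add: fun_eq_iff)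
  have "observable Y" using observable_comp assms by blast
  then have fin: "finite (range X)" "finite (range Y)"
    using assms by (auto simp: observable_def)
  have "fibre_entropy m Y = (\<Sum>w\<in>range Y. eta (\<Sum>v | v \<in> range X \<and> g v = w. ?p v))"
    unfolding fibre_entropy_def
  proof (intro sum.cong refl arg_cong[where f = eta])
    fix w
    have "m (\<Union>v\<in>{v \<in> range X. g v = w}. X -` {v}) = (\<Sum>v | v \<in> range X \<and> g v = w. ?p v)"
      using assms by (intro content_UN) (auto simp: observable_def disjoint_family_on_def)
    moreover have "(\<Union>v\<in>{v \<in> range X. g v = w}. X -` {v}) = Y -` {w}"
      by (auto simp: Y)
    ultimately show "m (Y -` {w}) = (\<Sum>v | v \<in> range X \<and> g v = w. ?p v)" by simp
  qed
  also have "\<dots> \<le> (\<Sum>w\<in>range Y. \<Sum>v | v \<in> range X \<and> g v = w. eta (?p v))"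
    using fin assms by (intro sum_mono eta_sum_le nonneg) (auto intro: finite_subset)
  also have "\<dots> = (\<Sum>v\<in>range X. eta (?p v))"
    using fin by (intro sum.group) (auto simp: Y)
  finally show ?thesis by (simp add: fibre_entropy_def)
qed

text \<open>For each value of \<open>Z\<close>, \<open>eta_matrix\<close> applies to the joint
  contents of \<open>X\<close> and \<open>Y\<close> on that fibre. Summation gives H(X,Y|Z) \<le>
  H(X|Z) + H(Y|Z), written without subtraction.\<close>

lemma fibre_entropy_submodular:
  assumes X: "observable X" and Y: "observable Y" and Z: "observable Z"
  shows "fibre_entropy m (\<lambda>\<omega>. (X \<omega>, Y \<omega>, Z \<omega>)) + fibre_entropy m Z
    \<le> fibre_entropy m (\<lambda>\<omega>. (X \<omega>, Z \<omega>)) + fibre_entropy m (\<lambda>\<omega>. (Y \<omega>, Z \<omega>))"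
proof -
  let ?A = "range X" and ?B = "range Y" and ?D = "range Z"
  define p where "p z x y = m (X -` {x} \<inter> Y -` {y} \<inter> Z -` {z})" for x y z
  note fin = observable_finite[OF X] observable_finite[OF Y] observable_finite[OF Z]
  have p0: "0 \<le> p z x y" for x y z
    unfolding p_def using X Y Z by (intro nonneg) auto
  have XZ: "m (X -` {x} \<inter> Z -` {z}) = (\<Sum>y\<in>?B. p z x y)" for x z
    using content_sum_fibres[OF Y, of "X -` {x} \<inter> Z -` {z}"] X Z
    by (auto simp: p_def Int_ac observable_fibre)
  have YZ: "m (Y -` {y} \<inter> Z -` {z}) = (\<Sum>x\<in>?A. p z x y)" for y z
    using content_sum_fibres[OF X, of "Y -` {y} \<inter> Z -` {z}"] Y Z
    by (auto simp: p_def Int_ac observable_fibre)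
  have Z': "m (Z -` {z}) = (\<Sum>x\<in>?A. \<Sum>y\<in>?B. p z x y)" for z
    using content_sum_fibres[OF X, of "Z -` {z}"] Z
    by (simp add: XZ observable_fibre)
  have 1: "fibre_entropy m (\<lambda>\<omega>. (X \<omega>, Y \<omega>, Z \<omega>)) = (\<Sum>z\<in>?D. \<Sum>x\<in>?A. \<Sum>y\<in>?B. eta (p z x y))"
  proof -
    have "fibre_entropy m (\<lambda>\<omega>. (X \<omega>, Y \<omega>, Z \<omega>))
      = (\<Sum>v\<in>?A \<times> ?B \<times> ?D. eta (m ((\<lambda>\<omega>. (X \<omega>, Y \<omega>, Z \<omega>)) -` {v})))"
      using fin by (intro fibre_entropy_superset) auto
    also have "\<dots> = (\<Sum>x\<in>?A. \<Sum>y\<in>?B. \<Sum>z\<in>?D. eta (m ((\<lambda>\<omega>. (X \<omega>, Y \<omega>, Z \<omega>)) -` {(x, y, z)})))"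
      by (simp add: sum.cartesian_product)
    also have "\<dots> = (\<Sum>x\<in>?A. \<Sum>y\<in>?B. \<Sum>z\<in>?D. eta (p z x y))"
      unfolding p_def
      by (intro sum.cong refl arg_cong[where f = eta] arg_cong[where f = m]) auto
    also have "\<dots> = (\<Sum>x\<in>?A. \<Sum>z\<in>?D. \<Sum>y\<in>?B. eta (p z x y))"
      by (intro sum.cong refl) (rule sum.swap)
    also have "\<dots> = (\<Sum>z\<in>?D. \<Sum>x\<in>?A. \<Sum>y\<in>?B. eta (p z x y))"
      by (rule sum.swap)
    finally show ?thesis .
  qed
  have pair: "fibre_entropy m (\<lambda>\<omega>. (W \<omega>, Z \<omega>)) = (\<Sum>z\<in>?D. \<Sum>x\<in>range W. eta (m (W -` {x} \<inter> Z -` {z})))"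
    if "observable W" for W :: "'a \<Rightarrow> 'w"
  proof -
    have "fibre_entropy m (\<lambda>\<omega>. (W \<omega>, Z \<omega>))
      = (\<Sum>v\<in>range W \<times> ?D. eta (m ((\<lambda>\<omega>. (W \<omega>, Z \<omega>)) -` {v})))"
      using fin observable_finite[OF that] by (intro fibre_entropy_superset) auto
    also have "\<dots> = (\<Sum>x\<in>range W. \<Sum>z\<in>?D. eta (m ((\<lambda>\<omega>. (W \<omega>, Z \<omega>)) -` {(x, z)})))"
      by (simp add: sum.cartesian_product)
    also have "\<dots> = (\<Sum>x\<in>range W. \<Sum>z\<in>?D. eta (m (W -` {x} \<inter> Z -` {z})))"
      by (intro sum.cong refl arg_cong[where f = eta] arg_cong[where f = m]) auto
    finally show ?thesis by (subst sum.swap) simp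
  qed
  have "(\<Sum>z\<in>?D. (\<Sum>x\<in>?A. \<Sum>y\<in>?B. eta (p z x y)) + eta (\<Sum>x\<in>?A. \<Sum>y\<in>?B. p z x y))
    \<le> (\<Sum>z\<in>?D. (\<Sum>x\<in>?A. eta (\<Sum>y\<in>?B. p z x y)) + (\<Sum>y\<in>?B. eta (\<Sum>x\<in>?A. p z x y)))"
    using fin p0 by (intro sum_mono eta_matrix) auto
  then show ?thesis
    unfolding 1 pair[OF X] pair[OF Y] XZ YZ
    by (simp add: fibre_entropy_def Z' sum.distrib)
qed

lemma fibre_entropy_const: "fibre_entropy m (\<lambda>_. c) = 0"
  by (simp add: fibre_entropy_def total)

lemma fibre_entropy_Pair_le:
  assumes "observable X" "observable Y"
  shows "fibre_entropy m (\<lambda>\<omega>. (X \<omega>, Y \<omega>)) \<le> fibre_entropy m X + fibre_entropy m Y"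
proof -
  \<comment> \<open>Conditioning on a constant turns submodularity into subadditivity.\<close>
  have c: "observable (\<lambda>_. ())"
    by (rule observable_comp[OF assms(1), of _ "\<lambda>_. ()"]) simp
  have "fibre_entropy m (\<lambda>\<omega>. (X \<omega>, Y \<omega>)) \<le> fibre_entropy m (\<lambda>\<omega>. (X \<omega>, Y \<omega>, ()))"
    by (rule fibre_entropy_mono[where g = "\<lambda>(x, y, z). (x, y)"])
       (use assms c in \<open>auto intro!: observable_Pair\<close>)
  moreover have "fibre_entropy m (\<lambda>\<omega>. (X \<omega>, ())) \<le> fibre_entropy m X"
    by (rule fibre_entropy_mono[where g = "\<lambda>x. (x, ())"]) (use assms in auto)
  moreover have "fibre_entropy m (\<lambda>\<omega>. (Y \<omega>, ())) \<le> fibre_entropy m Y"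
    by (rule fibre_entropy_mono[where g = "\<lambda>x. (x, ())"]) (use assms in auto)
  ultimately show ?thesis
    using fibre_entropy_submodular[OF assms c] fibre_entropy_const[of "()"] by linarith
qed

text \<open>Comparison with the uniform weight on the labels in \<open>W\<close>. Fibres outside
  \<open>W\<close> need only have content 0, not be empty: this absorbs the orbits that enter a
  compact set from outside.\<close>

lemma fibre_entropy_le_ln_card:
  assumes X: "observable X" and W: "finite W" "\<And>v. v \<notin> W \<Longrightarrow> m (X -` {v}) = 0"
  shows "fibre_entropy m X \<le> ln (card W)"
proof -
  let ?V = "range X \<inter> W" and ?p = "\<lambda>v. m (X -` {v})"
  have sub: "(\<Sum>v\<in>range X. f (?p v)) = (\<Sum>v\<in>?V. f (?p v))" if "f 0 = 0" for f :: "real \<Rightarrow> real"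
    using observable_finite[OF X] W that by (intro sum.mono_neutral_right) auto
  have one: "(\<Sum>v\<in>?V. ?p v) = 1"
    using content_sum_fibres[OF X, of UNIV] sub[of "\<lambda>x. x"] by (simp add: total)
  then have "?V \<noteq> {}" by (intro notI) simp
  then have c: "card ?V > 0" "card ?V \<le> card W"
    using W by (auto simp: card_gt_0_iff intro: card_mono)
  have "fibre_entropy m X = (\<Sum>v\<in>?V. eta (?p v))"
    unfolding fibre_entropy_def by (rule sub) simp
  also have "\<dots> \<le> (\<Sum>v\<in>?V. - ?p v * ln (1 / card ?V) + (1 / card ?V - ?p v))"
    using X c by (intro sum_mono eta_gibbs nonneg) auto
  also have "\<dots> = - (\<Sum>v\<in>?V. ?p v) * ln (1 / card ?V) + (card ?V * (1 / card ?V) - (\<Sum>v\<in>?V. ?p v))"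
    by (simp add: sum.distrib sum_subtractf sum_distrib_right sum_negf)
  also have "\<dots> = ln (card ?V)"
    using c by (simp add: one ln_div)
  also have "\<dots> \<le> ln (card W)" using c by simp
  finally show ?thesis .
qed

end

subsection \<open>Itineraries\<close>

text \<open>The observable whose nonempty fibres are the nonempty cells of the n-fold join. With
  lists, successive blocks of time are concatenated by append.\<close>

definition itinerary :: "('a \<Rightarrow> 'a) \<Rightarrow> ('a \<Rightarrow> 'b) \<Rightarrow> nat \<Rightarrow> 'a \<Rightarrow> 'b list" where
  "itinerary f p n x = map (\<lambda>i. p ((f ^^ i) x)) [0..<n]"

lemma itinerary_0 [simp]: "itinerary f p 0 x = []"
  by (simp add: itinerary_def)

lemma length_itinerary [simp]: "length (itinerary f p n x) = n"
  by (simp add: itinerary_def)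

lemma nth_itinerary [simp]: "i < n \<Longrightarrow> itinerary f p n x ! i = p ((f ^^ i) x)"
  by (simp add: itinerary_def)

lemma itinerary_add: "itinerary f p (a + b) x = itinerary f p a x @ itinerary f p b ((f ^^ a) x)"
  by (rule nth_equalityI) (auto simp: nth_append simp flip: funpow_add[THEN fun_cong, simplified])

lemma itinerary_eq_iff:
  "itinerary f p n x = itinerary f p n y \<longleftrightarrow> (\<forall>i<n. p ((f ^^ i) x) = p ((f ^^ i) y))"
  by (auto simp: list_eq_iff_nth_eq)

lemma take_itinerary: "a \<le> n \<Longrightarrow> take a (itinerary f p n x) = itinerary f p a x"
  by (simp add: itinerary_def take_map)

lemma range_itinerary: "range (itinerary f p n) \<subseteq> {xs. set xs \<subseteq> range p \<and> length xs = n}"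
  by (auto simp: itinerary_def)

lemma funpow_mult_apply:
  fixes f :: "'a \<Rightarrow> 'a"
  shows "((f ^^ a) ^^ i) x = (f ^^ (a * i)) x"
  by (simp add: funpow_mult)

text \<open>A point of a member determines it: the cell prescribed at time i must be the one
  containing the i-th iterate. Words that no point realises give only the empty set, which is
  removed.\<close>

lemma iterated_join_fibres:
  "iterated_join UNIV f ((\<lambda>v. p -` {v}) ` range p) n - {{}}
    = (\<lambda>w. itinerary f p n -` {w}) ` range (itinerary f p n)" (is "?L = ?R")
proof
  show "?L \<subseteq> ?R"
  proof
    fix B assume B: "B \<in> ?L"
    then obtain x where x: "x \<in> B" by blast
    from B have "B \<in> iterated_join UNIV f ((\<lambda>v. p -` {v}) ` range p) n" by blast
    then obtain U where U: "B = UNIV \<inter> (\<Inter>i<n. (f ^^ i) -` U i)" "\<forall>i<n. U i \<in> (\<lambda>v. p -` {v}) ` range p"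
      unfolding iterated_join_def mem_Collect_eq by (elim exE conjE)
    have "(f ^^ i) -` U i = {y. p ((f ^^ i) y) = p ((f ^^ i) x)}" if "i < n" for i
    proof -
      have "U i \<in> (\<lambda>v. p -` {v}) ` range p" using U(2) that by blast
      then obtain v where v: "U i = p -` {v}" by blast
      have "(f ^^ i) x \<in> U i" using U(1) x that by blast
      then show ?thesis by (auto simp: v)
    qed
    then have "B = {y. \<forall>i<n. p ((f ^^ i) y) = p ((f ^^ i) x)}"
      unfolding U(1) by blast
    also have "\<dots> = itinerary f p n -` {itinerary f p n x}"
      by (auto simp: itinerary_eq_iff)
    finally show "B \<in> ?R" by blast
  qed
next
  show "?R \<subseteq> ?L"
  proof
    fix B assume "B \<in> ?R"
    then obtain x where B: "B = itinerary f p n -` {itinerary f p n x}" by blast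
    define U where "U i = p -` {p ((f ^^ i) x)}" for i
    have "B = UNIV \<inter> (\<Inter>i<n. (f ^^ i) -` U i)"
      unfolding B U_def by (auto simp: itinerary_eq_iff)
    moreover have "\<forall>i<n. U i \<in> (\<lambda>v. p -` {v}) ` range p"
      by (simp add: U_def)
    ultimately have "B \<in> iterated_join UNIV f ((\<lambda>v. p -` {v}) ` range p) n"
      unfolding iterated_join_def mem_Collect_eq by (intro exI conjI)
    moreover have "x \<in> B" by (simp add: B)
    ultimately show "B \<in> ?L" by blast
  qed
qed

text \<open>Invariance is kept apart, because counting measures on separated sets need not have
  it.\<close>

locale content_map = prob_content F m for F :: "'a set set" and m +
  fixes f :: "'a \<Rightarrow> 'a"
  assumes measurable_map: "A \<in> F \<Longrightarrow> f -` A \<in> F"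
begin

lemma funpow_vimage: "A \<in> F \<Longrightarrow> (f ^^ i) -` A \<in> F"
  by (induction i arbitrary: A) (auto simp: funpow_swap1 vimage_comp[symmetric] measurable_map)

lemma observable_funpow:
  assumes "observable X"
  shows "observable (\<lambda>x. X ((f ^^ i) x))"
proof -
  have "(\<lambda>x. X ((f ^^ i) x)) -` {v} = (f ^^ i) -` (X -` {v})" for v by auto
  moreover have "finite (range (\<lambda>x. X ((f ^^ i) x)))"
    by (rule finite_subset[OF _ observable_finite[OF assms]]) auto
  ultimately show ?thesis
    using funpow_vimage assms by (simp add: observable_def)
qed

lemma observable_itinerary:
  assumes "observable p"
  shows "observable (itinerary f p n)"
proof (induction n)
  case 0
  show ?case
    by (rule observable_comp[OF assms, of _ "\<lambda>_. []"]) simp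
next
  case (Suc n)
  show ?case
    by (rule observable_comp[OF observable_Pair[OF Suc observable_funpow[OF assms, of n]],
          of _ "\<lambda>(u, v). u @ [v]"])
       (simp add: itinerary_def)
qed

lemma entropy_itinerary_nonneg: "observable p \<Longrightarrow> 0 \<le> fibre_entropy m (itinerary f p n)"
  by (intro fibre_entropy_nonneg observable_itinerary)

text \<open>The starting time \<open>i\<close> is carried along, since without invariance a block
  may have different entropy at different times.\<close>

lemma entropy_itinerary_add:
  assumes "observable p"
  shows "fibre_entropy m (\<lambda>x. itinerary f p (a + b) ((f ^^ i) x))
    \<le> fibre_entropy m (\<lambda>x. itinerary f p a ((f ^^ i) x))
      + fibre_entropy m (\<lambda>x. itinerary f p b ((f ^^ (i + a)) x))"
proof -
  note obs = observable_funpow[OF observable_itinerary[OF assms]]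
  have eq: "(f ^^ a) ((f ^^ i) x) = (f ^^ (i + a)) x" for x
    by (simp add: add.commute[of i a] funpow_add)
  have "fibre_entropy m (\<lambda>x. itinerary f p (a + b) ((f ^^ i) x))
    \<le> fibre_entropy m (\<lambda>x. (itinerary f p a ((f ^^ i) x), itinerary f p b ((f ^^ (i + a)) x)))"
    by (rule fibre_entropy_mono[where g = "\<lambda>(u, v). u @ v", OF observable_Pair[OF obs obs]])
       (simp add: itinerary_add eq)
  also have "\<dots> \<le> fibre_entropy m (\<lambda>x. itinerary f p a ((f ^^ i) x))
      + fibre_entropy m (\<lambda>x. itinerary f p b ((f ^^ (i + a)) x))"
    by (rule fibre_entropy_Pair_le[OF obs obs])
  finally show ?thesis .
qed

lemma entropy_itinerary_le:
  assumes "observable p" "c = card (range p)"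
  shows "fibre_entropy m (itinerary f p n) \<le> n * ln c"
proof -
  let ?W = "{xs. set xs \<subseteq> range p \<and> length xs = n}"
  have fin: "finite (range p)" by (rule observable_finite[OF assms(1)])
  have "itinerary f p n -` {v} = {}" if "v \<notin> ?W" for v
    using range_itinerary[of f p n] that by blast
  then have "fibre_entropy m (itinerary f p n) \<le> ln (card ?W)"
    using fin assms
    by (intro fibre_entropy_le_ln_card observable_itinerary finite_lists_length_eq) auto
  also have "card ?W = c ^ n"
    using fin assms by (simp add: card_lists_length_eq)
  also have "ln (c ^ n) = n * ln c"
    by (cases "c = 0") (use assms fin in \<open>auto simp: ln_realpow\<close>)
  finally show ?thesis .
qed

text \<open>Cutting \<open>[i, n)\<close> at \<open>i + q\<close> bounds its entropy \<open>e i\<close> by that of a block of length \<open>q\<close> plus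
  \<open>e (i + q)\<close>; summing over all \<open>i < n\<close> telescopes and leaves \<open>e 0 + \<dots> + e (q - 1)\<close>.\<close>

lemma entropy_itinerary_blocks:
  assumes p: "observable p" "c = card (range p)" and q: "q \<le> n"
  shows "q * fibre_entropy m (itinerary f p n)
    \<le> (\<Sum>i<n. fibre_entropy m (\<lambda>x. itinerary f p q ((f ^^ i) x))) + q * q * ln c"
proof -
  define e where "e i = fibre_entropy m (\<lambda>x. itinerary f p (n - i) ((f ^^ i) x))" for i
  define a where "a i = fibre_entropy m (\<lambda>x. itinerary f p q ((f ^^ i) x))" for i
  note obs = observable_funpow[OF observable_itinerary[OF p(1)]]
  have e_step: "e i \<le> a i + e (i + q)" for i
  proof (cases "i + q \<le> n")
    case True
    then have "n - i = q + (n - (i + q))" by simp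
    then show ?thesis
      unfolding e_def a_def using entropy_itinerary_add[OF p(1), of q "n - (i + q)" i] by simp
  next
    \<comment> \<open>Near the end the block of length \<open>q\<close> reaches beyond
      \<open>n\<close>; the remaining itinerary is then a prefix of it.\<close>
    case False
    then have "e i \<le> a i"
      unfolding e_def a_def
      by (intro fibre_entropy_mono[where g = "take (n - i)"] obs) (simp add: take_itinerary)
    moreover have "e (i + q) \<ge> 0"
      unfolding e_def by (intro fibre_entropy_nonneg obs)
    ultimately show ?thesis by simp
  qed
  have e_zero: "e i = 0" if "i \<ge> n" for i
    using that fibre_entropy_const[of "[]"] by (simp add: e_def)
  have "(\<Sum>i<n. e (i + q)) = (\<Sum>i\<in>{q..<n+q}. e i)"
    by (rule sum.reindex_bij_witness[of _ "\<lambda>i. i - q" "\<lambda>i. i + q"]) auto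
  also have "\<dots> = (\<Sum>i\<in>{q..<n}. e i)"
    by (rule sum.mono_neutral_right) (auto simp: e_zero)
  finally have shift: "(\<Sum>i<n. e (i + q)) = (\<Sum>i\<in>{q..<n}. e i)" .
  have "(\<Sum>i<n. e i) \<le> (\<Sum>i<n. a i + e (i + q))"
    by (intro sum_mono e_step)
  then have "(\<Sum>i<n. e i) \<le> (\<Sum>i<n. a i) + (\<Sum>i\<in>{q..<n}. e i)"
    by (simp add: sum.distrib shift)
  moreover have "{..<n} = {..<q} \<union> {q..<n}" using q by auto
  then have "(\<Sum>i<n. e i) = (\<Sum>i<q. e i) + (\<Sum>i\<in>{q..<n}. e i)"
    by (simp add: sum.union_disjoint ivl_disj_int)
  ultimately have le1: "(\<Sum>i<q. e i) \<le> (\<Sum>i<n. a i)" by simp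
  \<comment> \<open>Dropping the first \<open>i < q\<close> letters costs at most
    \<open>q * ln c\<close>. Applied to \<open>q\<close> summands, this is the source of the error
    \<open>q * q * ln c\<close>.\<close>
  have "e 0 \<le> q * ln c + e i" if "i < q" for i
  proof -
    have "e 0 \<le> fibre_entropy m (itinerary f p i) + e i"
      unfolding e_def using entropy_itinerary_add[OF p(1), of i "n - i" 0] that q by simp
    also have "fibre_entropy m (itinerary f p i) \<le> i * ln c"
      by (rule entropy_itinerary_le[OF p])
    also have "i * ln c \<le> q * ln c"
      using that p(2) by (intro mult_right_mono) (auto simp: card_gt_0_iff Suc_le_eq observable_finite[OF p(1)] intro!: ln_ge_zero)
    finally show ?thesis by simp
  qed
  then have "(\<Sum>i<q. e 0) \<le> (\<Sum>i<q. q * ln c + e i)"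
    by (intro sum_mono) auto
  then have "q * e 0 \<le> q * (q * ln c) + (\<Sum>i<q. e i)"
    by (simp add: sum.distrib)
  moreover have "e 0 = fibre_entropy m (itinerary f p n)" by (simp add: e_def)
  ultimately show ?thesis
    using le1 by (simp add: a_def algebra_simps)
qed

end

locale invariant_content = content_map +
  assumes invariant: "A \<in> F \<Longrightarrow> m (f -` A) = m A"
begin

lemma funpow_invariant: "A \<in> F \<Longrightarrow> m ((f ^^ i) -` A) = m A"
proof (induction i)
  case (Suc i)
  have "(f ^^ Suc i) -` A = f -` ((f ^^ i) -` A)"
    by (auto simp: funpow_swap1)
  then have "m ((f ^^ Suc i) -` A) = m (f -` ((f ^^ i) -` A))"
    by (rule arg_cong)
  also have "\<dots> = m A"
    using Suc invariant[OF funpow_vimage[OF Suc.prems]] by simp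
  finally show ?case .
qed simp

lemma fibre_entropy_invariant:
  assumes "observable X"
  shows "fibre_entropy m (\<lambda>x. X ((f ^^ i) x)) = fibre_entropy m X"
proof -
  have "fibre_entropy m (\<lambda>x. X ((f ^^ i) x)) = (\<Sum>v\<in>range X. eta (m ((\<lambda>x. X ((f ^^ i) x)) -` {v})))"
    using observable_finite[OF assms] by (intro fibre_entropy_superset) auto
  also have "\<dots> = (\<Sum>v\<in>range X. eta (m (X -` {v})))"
  proof (intro sum.cong refl arg_cong[where f = eta])
    fix v
    have "(\<lambda>x. X ((f ^^ i) x)) -` {v} = (f ^^ i) -` (X -` {v})" by auto
    then show "m ((\<lambda>x. X ((f ^^ i) x)) -` {v}) = m (X -` {v})"
      using funpow_invariant[OF observable_fibre[OF assms]] by simp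
  qed
  finally show ?thesis by (simp add: fibre_entropy_def)
qed

lemma entropy_itinerary_subadditive:
  assumes "observable p"
  shows "fibre_entropy m (itinerary f p (a + b))
    \<le> fibre_entropy m (itinerary f p a) + fibre_entropy m (itinerary f p b)"
  using entropy_itinerary_add[OF assms, of a b 0]
    fibre_entropy_invariant[OF observable_itinerary[OF assms]] by simp

text \<open>The difference in parentheses is the conditional entropy \<open>H(r|q)\<close>.\<close>

lemma entropy_itinerary_conditional:
  assumes r: "observable r" and q: "observable q"
  shows "fibre_entropy m (itinerary f r n) \<le> fibre_entropy m (itinerary f q n)
    + n * (fibre_entropy m (\<lambda>x. (r x, q x)) - fibre_entropy m q)"
proof -
  let ?rq = "\<lambda>x. (r x, q x)"
  have rq: "observable ?rq" by (rule observable_Pair[OF r q])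
  note obs = observable_itinerary[OF r] observable_itinerary[OF q] observable_itinerary[OF rq]
  have "fibre_entropy m (\<lambda>x. (itinerary f r n x, itinerary f q n x))
    \<le> fibre_entropy m (itinerary f q n) + n * (fibre_entropy m ?rq - fibre_entropy m q)"
  proof (induction n)
    case 0
    show ?case by (simp add: fibre_entropy_const del: itinerary_def)
  next
    case (Suc n)
    let ?X = "itinerary f r n" and ?Z = "\<lambda>x. (itinerary f q n x, q ((f ^^ n) x))"
    let ?Y = "\<lambda>x. r ((f ^^ n) x)" and ?q = "\<lambda>x. q ((f ^^ n) x)"
    let ?Qn = "itinerary f q n"
    have oX: "observable ?X" and oQ: "observable ?Qn" by (fact obs)+
    have oY: "observable ?Y" and oq: "observable ?q"
      by (rule observable_funpow[OF r], rule observable_funpow[OF q])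
    have oZ: "observable ?Z" by (rule observable_Pair[OF oQ oq])
    have 1: "fibre_entropy m (\<lambda>x. (itinerary f r (Suc n) x, itinerary f q (Suc n) x))
      \<le> fibre_entropy m (\<lambda>x. (?X x, ?Y x, ?Z x))"
      by (rule fibre_entropy_mono[where g = "\<lambda>(u, v, w, z). (u @ [v], w @ [z])"])
         (simp_all add: itinerary_def observable_Pair[OF oX observable_Pair[OF oY oZ], unfolded itinerary_def])
    \<comment> \<open>In conditional form, with \<open>?Z\<close> carrying the q-word of length n +
      1: fact 2 is H(X,Y|Z) \<le> H(X|Z) + H(Y|Z), fact 3 gives H(X|Z) \<le> H(X|Qn), and fact 4
      gives H(Y|Z) \<le> H(Y|q) at time n. Facts 5 to 7 regroup tuples; facts 8 and 9 move time n
      back to time 0.\<close>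
    have 2: "fibre_entropy m (\<lambda>x. (?X x, ?Y x, ?Z x)) + fibre_entropy m ?Z
      \<le> fibre_entropy m (\<lambda>x. (?X x, ?Z x)) + fibre_entropy m (\<lambda>x. (?Y x, ?Z x))"
      by (rule fibre_entropy_submodular[OF oX oY oZ])
    have 3: "fibre_entropy m (\<lambda>x. (?X x, ?q x, ?Qn x)) + fibre_entropy m ?Qn
      \<le> fibre_entropy m (\<lambda>x. (?X x, ?Qn x)) + fibre_entropy m (\<lambda>x. (?q x, ?Qn x))"
      by (rule fibre_entropy_submodular[OF oX oq oQ])
    have 4: "fibre_entropy m (\<lambda>x. (?Y x, ?Qn x, ?q x)) + fibre_entropy m ?q
      \<le> fibre_entropy m (\<lambda>x. (?Y x, ?q x)) + fibre_entropy m (\<lambda>x. (?Qn x, ?q x))"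
      by (rule fibre_entropy_submodular[OF oY oQ oq])
    have 5: "fibre_entropy m (\<lambda>x. (?X x, ?Z x)) \<le> fibre_entropy m (\<lambda>x. (?X x, ?q x, ?Qn x))"
      by (rule fibre_entropy_mono[where g = "\<lambda>(u, v, w). (u, w, v)"])
         (auto intro!: observable_Pair oX oq oQ)
    have 6: "fibre_entropy m (\<lambda>x. (?q x, ?Qn x)) \<le> fibre_entropy m ?Z"
      by (rule fibre_entropy_mono[where g = "\<lambda>(u, v). (v, u)"]) (auto intro!: oZ)
    have 7: "fibre_entropy m ?Z \<le> fibre_entropy m (itinerary f q (Suc n))"
      by (rule fibre_entropy_mono[where g = "\<lambda>u. (take n u, u ! n)"])
         (auto intro!: obs simp: take_itinerary)
    have 8: "fibre_entropy m (\<lambda>x. (?Y x, ?q x)) = fibre_entropy m ?rq"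
      using fibre_entropy_invariant[OF rq] .
    have 9: "fibre_entropy m ?q = fibre_entropy m q"
      by (rule fibre_entropy_invariant[OF q])
    show ?case
      using 1 2 3 4 5 6 7 8 9 Suc by (simp add: algebra_simps)
  qed
  moreover have "fibre_entropy m (itinerary f r n)
    \<le> fibre_entropy m (\<lambda>x. (itinerary f r n x, itinerary f q n x))"
    by (rule fibre_entropy_mono[where g = fst]) (auto intro!: observable_Pair obs)
  ultimately show ?thesis by linarith
qed

end

section \<open>Translation between partitions and observables\<close>

lemma partition_entropy_fibres:
  assumes "space M = UNIV" "finite (range p)"
  shows "partition_entropy M (iterated_join (space M) f ((\<lambda>v. p -` {v}) ` range p) n)
    = fibre_entropy (measure M) (itinerary f p n)"
proof -
  let ?I = "iterated_join UNIV f ((\<lambda>v. p -` {v}) ` range p) n"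
  let ?W = "range (itinerary f p n)"
  have fin: "finite ?W"
    by (rule finite_subset[OF range_itinerary finite_lists_length_eq[OF assms(2)]])
  have "finite (?I - {{}})"
    unfolding iterated_join_fibres by (intro finite_imageI fin)
  \<comment> \<open>The defining sum runs over a set of sets. An empty member contributes
    \<open>eta 0\<close>, and distinct realised words have distinct fibres, so the sum can be
    indexed by words.\<close>
  then have "(\<Sum>P\<in>?I. eta (measure M P)) = (\<Sum>P\<in>?I - {{}}. eta (measure M P))"
    by (intro sum.mono_neutral_right) auto
  also have "\<dots> = (\<Sum>w\<in>?W. eta (measure M (itinerary f p n -` {w})))"
    unfolding iterated_join_fibres
    by (rule sum.reindex_cong[of "\<lambda>w. itinerary f p n -` {w}"]) (auto simp: inj_on_def vimage_def set_eq_iff)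
  finally show ?thesis
    by (simp add: assms partition_entropy_def fibre_entropy_def eta_def)
qed

lemma prob_content_measure:
  assumes "prob_space M" "space M = UNIV"
  shows "prob_content (sets M) (measure M)"
proof -
  interpret prob_space M by fact
  show ?thesis
  proof (intro prob_content.intro prob_content_axioms.intro)
    show "algebra UNIV (sets M)"
      using sets.algebra_axioms[of M] assms by simp
    show "measure M UNIV = 1"
      using prob_space assms by simp
  qed (auto intro: finite_measure_Union)
qed

lemma finite_measurable_partition_fibres:
  assumes "prob_space M" "space M = UNIV" and L: "finite_measurable_partition M \<P>"
  obtains p :: "'a \<Rightarrow> 'a set"
  where "prob_content.observable (sets M) p" "\<P> = (\<lambda>v. p -` {v}) ` range p"
proof -
  interpret prob_content "sets M" "measure M"
    by (rule prob_content_measure[OF assms(1,2)])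
  have P: "finite \<P>" "\<P> \<subseteq> sets M" "partition_on UNIV \<P>"
    using L assms(2) unfolding finite_measurable_partition_def by simp_all
  have ex1: "\<exists>!A. A \<in> \<P> \<and> x \<in> A" for x
  proof -
    obtain A where A: "A \<in> \<P>" "x \<in> A" using partition_onD1[OF P(3)] by blast
    show ?thesis
    proof (rule ex1I[of _ A])
      show "A \<in> \<P> \<and> x \<in> A" using A by simp
      show "B = A" if "B \<in> \<P> \<and> x \<in> B" for B
        using disjointD[OF partition_onD2[OF P(3)], of B A] A that by blast
    qed
  qed
  \<comment> \<open>Each point is labelled by its own cell, so the fibre over a cell is that
    cell.\<close>
  define p where "p x = (THE A. A \<in> \<P> \<and> x \<in> A)" for x
  have p: "p x \<in> \<P>" "x \<in> p x" for x
    using theI'[OF ex1[of x]] by (auto simp: p_def)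
  have p_eq: "p x = A \<longleftrightarrow> x \<in> A" if "A \<in> \<P>" for x A
    using p[of x] ex1[of x] that by metis
  have range_p: "range p = \<P>"
  proof
    show "\<P> \<subseteq> range p"
    proof
      fix A assume "A \<in> \<P>"
      moreover from this obtain x where "x \<in> A"
        using partition_onD3[OF P(3)] by (metis ex_in_conv)
      ultimately show "A \<in> range p" using p_eq by blast
    qed
  qed (use p in auto)
  have fib: "p -` {A} = A" if "A \<in> \<P>" for A
    using p_eq[OF that] by auto
  have "p -` {A} \<in> sets M" for A
  proof (cases "A \<in> \<P>")
    case False
    then have "p -` {A} = {}" using range_p by auto
    then show ?thesis by simp
  qed (use fib P in auto)
  then have "observable p"
    using P range_p by (simp add: observable_def)
  moreover have "\<P> = (\<lambda>v. p -` {v}) ` range p"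
    unfolding range_p using fib by auto
  ultimately show ?thesis by (rule that)
qed

lemma partition_of_observable:
  assumes "space M = UNIV" "finite (range p)" "\<And>v. p -` {v} \<in> sets M"
  shows "finite_measurable_partition M ((\<lambda>v. p -` {v}) ` range p)"
  unfolding finite_measurable_partition_def partition_on_def disjoint_def
  using assms by auto

subsection \<open>Cover numbers\<close>

lemma cover_number_le:
  assumes "\<B> \<subseteq> \<A>" "finite \<B>" "\<Union>\<B> = S"
  shows "cover_number S \<A> \<le> card \<B>"
  unfolding cover_number_def by (rule Least_le) (use assms in blast)

text \<open>The \<open>LEAST\<close> in \<open>cover_number\<close> is attained only if some finite
  subcover exists; \<open>\<B>\<^sub>0\<close> supplies one.\<close>

lemma cover_number_attained:
  assumes "\<B>\<^sub>0 \<subseteq> \<A>" "finite \<B>\<^sub>0" "\<Union>\<B>\<^sub>0 = S"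
  obtains \<B> where "\<B> \<subseteq> \<A>" "finite \<B>" "\<Union>\<B> = S" "card \<B> = cover_number S \<A>"
proof -
  have "\<exists>\<B>\<subseteq>\<A>. finite \<B> \<and> \<Union>\<B> = S \<and> card \<B> = cover_number S \<A>"
    unfolding cover_number_def by (rule LeastI_ex) (use assms in blast)
  then show ?thesis using that by blast
qed

lemma funpow_image_subset:
  assumes "f ` S \<subseteq> S" "x \<in> S"
  shows "(f ^^ i) x \<in> S"
  using assms by (induction i) auto

text \<open>Off \<open>S\<close> the restricted map is \<open>undefined\<close>, but members of the
  join lie in \<open>S\<close>, and orbits starting there never leave it.\<close>

lemma iterated_join_restrict:
  assumes "f ` S \<subseteq> S"
  shows "iterated_join S (restrict f S) \<U> n = iterated_join S f \<U> n"
proof -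
  have "(restrict f S ^^ i) x = (f ^^ i) x" if "x \<in> S" for i x
    using funpow_image_subset[OF assms that] by (induction i) auto
  then have "S \<inter> (\<Inter>i<n. (restrict f S ^^ i) -` U i) = S \<inter> (\<Inter>i<n. (f ^^ i) -` U i)" for U
    by auto
  then show ?thesis by (simp add: iterated_join_def)
qed

lemma iterated_join_I:
  "(\<And>i. i < n \<Longrightarrow> U i \<in> \<U>) \<Longrightarrow> S \<inter> (\<Inter>i<n. (f ^^ i) -` U i) \<in> iterated_join S f \<U> n"
  unfolding iterated_join_def by blast

lemma iterated_join_E:
  assumes "B \<in> iterated_join S f \<U> n"
  obtains U where "B = S \<inter> (\<Inter>i<n. (f ^^ i) -` U i)" "\<forall>i<n. U i \<in> \<U>"
  using assms that unfolding iterated_join_def by auto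

lemma finite_subcover_iterated_join:
  assumes f: "f ` S \<subseteq> S" and \<B>: "\<B> \<subseteq> \<A>" "finite \<B>" "\<Union>\<B> = S"
  obtains \<D> where "\<D> \<subseteq> iterated_join S f \<A> n" "finite \<D>" "\<Union>\<D> = S"
proof
  \<comment> \<open>\<open>PiE\<close> fixes the values beyond \<open>n\<close>, which leaves
    finitely many words.\<close>
  let ?\<D> = "(\<lambda>U. S \<inter> (\<Inter>i<n. (f ^^ i) -` U i)) ` ({..<n} \<rightarrow>\<^sub>E \<B>)"
  show "?\<D> \<subseteq> iterated_join S f \<A> n"
  proof
    fix B assume "B \<in> ?\<D>"
    then obtain U where U: "B = S \<inter> (\<Inter>i<n. (f ^^ i) -` U i)" "U \<in> {..<n} \<rightarrow>\<^sub>E \<B>" by blast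
    show "B \<in> iterated_join S f \<A> n"
      unfolding U(1) by (rule iterated_join_I) (use U(2) \<B> in auto)
  qed
  show "finite ?\<D>" using \<B> by (intro finite_imageI finite_PiE) auto
  show "\<Union>?\<D> = S"
  proof
    show "S \<subseteq> \<Union>?\<D>"
    proof
      fix x assume x: "x \<in> S"
      have "\<exists>B\<in>\<B>. (f ^^ i) x \<in> B" for i
        using funpow_image_subset[OF f x, of i] \<B> by blast
      then obtain U where U: "\<And>i. U i \<in> \<B>" "\<And>i. (f ^^ i) x \<in> U i" by metis
      have "x \<in> S \<inter> (\<Inter>i<n. (f ^^ i) -` (restrict U {..<n}) i)"
        using x U by auto
      moreover have "restrict U {..<n} \<in> {..<n} \<rightarrow>\<^sub>E \<B>" using U by auto
      ultimately show "x \<in> \<Union>?\<D>" by blast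
    qed
  qed auto
qed

text \<open>A minimal subcover for the first \<open>a\<close> times is intersected with the
  pull-back by \<open>f ^^ a\<close> of one for the next \<open>b\<close> times; the pull-back
  covers \<open>S\<close> because \<open>S\<close> is invariant.\<close>

lemma cover_number_iterated_join_add:
  assumes f: "f ` S \<subseteq> S" and \<B>: "\<B> \<subseteq> \<A>" "finite \<B>" "\<Union>\<B> = S"
  shows "cover_number S (iterated_join S f \<A> (a + b))
    \<le> cover_number S (iterated_join S f \<A> a) * cover_number S (iterated_join S f \<A> b)"
proof -
  have "\<exists>\<D>\<subseteq>iterated_join S f \<A> n. finite \<D> \<and> \<Union>\<D> = S \<and>
      card \<D> = cover_number S (iterated_join S f \<A> n)" for n
    using finite_subcover_iterated_join[OF assms, of n] cover_number_attained by metis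
  then obtain D where D: "\<And>n. D n \<subseteq> iterated_join S f \<A> n" "\<And>n. finite (D n)" "\<And>n. \<Union>(D n) = S"
      "\<And>n. card (D n) = cover_number S (iterated_join S f \<A> n)"
    by metis
  let ?\<D> = "(\<lambda>(A, B). A \<inter> (f ^^ a) -` B) ` (D a \<times> D b)"
  have "cover_number S (iterated_join S f \<A> (a + b)) \<le> card ?\<D>"
  proof (rule cover_number_le)
    show "finite ?\<D>" using D by auto
    show "\<Union>?\<D> = S"
    proof
      show "\<Union>?\<D> \<subseteq> S" using D(3)[of a] by auto
      show "S \<subseteq> \<Union>?\<D>"
      proof
        fix x assume x: "x \<in> S"
        obtain A where A: "A \<in> D a" "x \<in> A" using x D(3)[of a] by blast
        obtain B where B: "B \<in> D b" "(f ^^ a) x \<in> B"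
          using funpow_image_subset[OF f x, of a] D(3)[of b] by blast
        show "x \<in> \<Union>?\<D>"
          using A B by (intro UnionI[of "A \<inter> (f ^^ a) -` B"]) auto
      qed
    qed
    show "?\<D> \<subseteq> iterated_join S f \<A> (a + b)"
    proof clarify
      fix A B assume "A \<in> D a" "B \<in> D b"
      then have "A \<in> iterated_join S f \<A> a" "B \<in> iterated_join S f \<A> b"
        using D(1) by auto
      obtain U where U: "A = S \<inter> (\<Inter>i<a. (f ^^ i) -` U i)" "\<forall>i<a. U i \<in> \<A>"
        using \<open>A \<in> iterated_join S f \<A> a\<close> by (rule iterated_join_E)
      obtain V where V: "B = S \<inter> (\<Inter>i<b. (f ^^ i) -` V i)" "\<forall>i<b. V i \<in> \<A>"
        using \<open>B \<in> iterated_join S f \<A> b\<close> by (rule iterated_join_E)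
      define W where "W i = (if i < a then U i else V (i - a))" for i
      have "x \<in> A \<inter> (f ^^ a) -` B \<longleftrightarrow> x \<in> S \<inter> (\<Inter>i<a + b. (f ^^ i) -` W i)" for x
      proof (cases "x \<in> S")
        case True
        have "(\<forall>i<a + b. (f ^^ i) x \<in> W i) \<longleftrightarrow>
            (\<forall>i<a. (f ^^ i) x \<in> U i) \<and> (\<forall>i<b. (f ^^ (i + a)) x \<in> V i)"
        proof safe
          fix i assume *: "\<forall>i<a + b. (f ^^ i) x \<in> W i"
          show "(f ^^ i) x \<in> U i" if "i < a"
            using *[rule_format, of i] that by (simp add: W_def)
          show "(f ^^ (i + a)) x \<in> V i" if "i < b"
            using *[rule_format, of "i + a"] that by (simp add: W_def)
        next
          fix i assume *: "\<forall>i<a. (f ^^ i) x \<in> U i" "\<forall>i<b. (f ^^ (i + a)) x \<in> V i" "i < a + b"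
          show "(f ^^ i) x \<in> W i"
          proof (cases "i < a")
            case False
            with *(2)[rule_format, of "i - a"] *(3) show ?thesis by (simp add: W_def)
          qed (use * in \<open>simp add: W_def\<close>)
        qed
        then show ?thesis
          unfolding U(1) V(1)
          using True funpow_image_subset[OF f True, of a] by (auto simp: funpow_add)
      qed (simp add: U)
      then have "A \<inter> (f ^^ a) -` B = S \<inter> (\<Inter>i<a + b. (f ^^ i) -` W i)" by blast
      also have "\<dots> \<in> iterated_join S f \<A> (a + b)"
        by (rule iterated_join_I) (use U V in \<open>auto simp: W_def\<close>)
      finally show "A \<inter> (f ^^ a) -` B \<in> iterated_join S f \<A> (a + b)" .
    qed
  qed
  also have "\<dots> \<le> card (D a \<times> D b)"
    using D by (intro card_image_le) auto
  finally show ?thesis by (simp add: card_cartesian_product D)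
qed

text \<open>Complements of relatively open sets are closed in a compact space, hence compact; what
  survives of admissibility is that the cover has a member.\<close>

lemma admissible_cover_compact:
  assumes "compact C"
  shows "admissible_cover (top_of_set C) \<A> \<longleftrightarrow>
    (\<forall>A\<in>\<A>. openin (top_of_set C) A) \<and> \<Union>\<A> = C \<and> \<A> \<noteq> {}"
proof -
  have "compactin (top_of_set C) (C - A)" if "openin (top_of_set C) A" for A
  proof -
    have "compact_space (top_of_set C)"
      using assms by (simp add: compact_space_subtopology)
    moreover have "closedin (top_of_set C) (C - A)"
      using that by (simp add: closedin_diff)
    ultimately show ?thesis by (rule closedin_compact_space)
  qed
  then show ?thesis
    unfolding admissible_cover_def by auto
qed

lemma admissible_finite_subcover:
  assumes "compact C" "admissible_cover (top_of_set C) \<A>"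
  obtains \<B> where "\<B> \<subseteq> \<A>" "finite \<B>" "\<Union>\<B> = C"
proof -
  have \<A>: "\<forall>A\<in>\<A>. openin (top_of_set C) A" "\<Union>\<A> = C"
    using assms by (auto simp: admissible_cover_compact)
  then obtain \<B> where \<B>: "\<B> \<subseteq> \<A>" "finite \<B>" "C \<subseteq> \<Union>\<B>"
    using assms(1) unfolding compact_eq_openin_cover by (metis order_refl)
  then have "\<Union>\<B> = C" using \<A>(2) by (intro equalityI) auto
  with \<B>(1,2) show ?thesis by (rule that)
qed

text \<open>Fekete's lemma for the logarithm of the submultiplicative cover numbers. For empty
  \<open>C\<close> they are all 0, and subadditivity rests on \<open>ln 0 = 0\<close>.\<close>

lemma topological_entropy_cover_tendsto:
  assumes C: "compact C" and f: "f ` C \<subseteq> C" and \<A>: "admissible_cover (top_of_set C) \<A>"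
  shows "(\<lambda>n. 1 / n * ln (cover_number C (iterated_join C f \<A> n)))
    \<longlonglongrightarrow> topological_entropy_cover (top_of_set C) (restrict f C) \<A>"
proof -
  obtain \<B> where \<B>: "\<B> \<subseteq> \<A>" "finite \<B>" "\<Union>\<B> = C"
    using admissible_finite_subcover[OF C \<A>] .
  let ?N = "\<lambda>n. cover_number C (iterated_join C f \<A> n)"
  have eq: "topological_entropy_cover (top_of_set C) (restrict f C) \<A> = lim (\<lambda>n. 1 / n * ln (?N n))"
    by (simp add: topological_entropy_cover_def iterated_join_restrict[OF f])
  have N: "?N n = 0 \<longleftrightarrow> C = {}" for n
  proof -
    obtain \<D>\<^sub>0 where "\<D>\<^sub>0 \<subseteq> iterated_join C f \<A> n" "finite \<D>\<^sub>0" "\<Union>\<D>\<^sub>0 = C"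
      using finite_subcover_iterated_join[OF f \<B>] .
    then obtain \<D> where \<D>: "\<D> \<subseteq> iterated_join C f \<A> n" "finite \<D>" "\<Union>\<D> = C" "card \<D> = ?N n"
      by (rule cover_number_attained)
    show ?thesis
    proof
      assume "?N n = 0"
      then have "\<D> = {}" using \<D>(2,4) by simp
      then show "C = {}" using \<D>(3) by simp
    next
      assume "C = {}"
      then show "?N n = 0"
        using cover_number_le[of "{}" "iterated_join C f \<A> n" C] by simp
    qed
  qed
  have "ln (?N (a + b)) \<le> ln (?N a) + ln (?N b)" for a b
  proof (cases "C = {}")
    case False
    then have "?N a > 0" "?N b > 0" "?N (a + b) > 0" using N by auto
    then have "ln (real (?N a) * real (?N b)) = ln (?N a) + ln (?N b)" by (simp add: ln_mult)
    moreover have "real (?N (a + b)) \<le> real (?N a) * real (?N b)"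
      using cover_number_iterated_join_add[OF f \<B>, of a b] by (metis of_nat_le_iff of_nat_mult)
    then have "ln (?N (a + b)) \<le> ln (real (?N a) * real (?N b))"
      using \<open>?N (a + b) > 0\<close> by (intro ln_mono) auto
    ultimately show ?thesis by simp
  next
    case True
    have "?N n = 0" for n by (rule iffD2[OF N True])
    then show ?thesis by simp
  qed
  moreover have "0 \<le> ln (?N a)" for a
    by (cases "?N a = 0") auto
  ultimately show ?thesis
    unfolding eq by (intro fekete_lim(1))
qed

subsection \<open>Measure entropy is bounded by topological entropy\<close>

text \<open>The label \<open>q\<close> forgets \<open>r\<close> outside the sets \<open>K v\<close>.
  The forgotten part is so rare that H(r|q) is at most 2, whatever the number of labels.\<close>

lemma (in prob_content) entropy_truncated_label:
  assumes r: "observable r" and K: "\<And>v. K v \<in> F" "\<And>v. K v \<subseteq> r -` {v}"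
    and \<delta>: "\<forall>v\<in>range r. m (r -` {v} - K v) \<le> \<delta>" "card (range r) * (2 * sqrt \<delta>) \<le> 1"
  defines "q \<equiv> \<lambda>x. if x \<in> K (r x) then Some (r x) else None"
  shows "observable q" and "q -` {Some v} = K v"
    and "fibre_entropy m (\<lambda>x. (r x, q x)) \<le> fibre_entropy m q + 2"
proof -
  let ?V = "range r"
  \<comment> \<open>\<open>d\<close> remembers \<open>r\<close> exactly where \<open>q\<close>
    forgets it, so the pair \<open>(q, d)\<close> determines \<open>r\<close>, and H(r|q) is at most
    the entropy of \<open>d\<close>.\<close>
  define d where "d x = (if x \<in> K (r x) then None else Some (r x))" for x
  have fin: "finite ?V" using r by (rule observable_finite)
  have K': "x \<in> K v \<Longrightarrow> r x = v" for x v using K(2) by blast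
  have UK: "(\<Union>v\<in>?V. K v) \<in> F" "(\<Union>v\<in>?V. r -` {v} - K v) \<in> F"
    by (intro finite_UN[OF fin] Diff K observable_fibre[OF r])+
  have "x \<in> (\<Union>v\<in>?V. K v) \<longleftrightarrow> x \<in> K (r x)" for x
  proof
    assume "x \<in> (\<Union>v\<in>?V. K v)"
    then obtain v where "x \<in> K v" by blast
    with K'[OF this] show "x \<in> K (r x)" by simp
  qed blast
  then have "(\<Union>v\<in>?V. K v) = {x. x \<in> K (r x)}" by blast
  then have qN: "q -` {None} = UNIV - (\<Union>v\<in>?V. K v)"
    by (auto simp: q_def simp del: UN_simps)
  have "q x = Some v \<longleftrightarrow> x \<in> K v" for x v
    using K'[of x v] by (auto simp: q_def)
  then have qS: "q -` {Some v} = K v" for v by auto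
  then show "q -` {Some v} = K v" .
  have q: "q -` {w} \<in> F" for w
    using UK K by (cases w) (auto simp: qN qS)
  have "range q \<subseteq> insert None (Some ` ?V)" by (auto simp: q_def)
  then have "finite (range q)" by (rule finite_subset) (use fin in simp)
  with q show oq: "observable q" by (simp add: observable_def)
  have "x \<in> (\<Union>v\<in>?V. r -` {v} - K v) \<longleftrightarrow> x \<notin> K (r x)" for x
  proof
    assume "x \<in> (\<Union>v\<in>?V. r -` {v} - K v)"
    then obtain v where "r x = v" "x \<notin> K v" by blast
    then show "x \<notin> K (r x)" by simp
  next
    assume "x \<notin> K (r x)"
    then show "x \<in> (\<Union>v\<in>?V. r -` {v} - K v)"
      by (intro UN_I[of "r x"]) auto
  qed
  then have "(\<Union>v\<in>?V. r -` {v} - K v) = {x. x \<notin> K (r x)}" by blast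
  then have dN: "d -` {None} = UNIV - (\<Union>v\<in>?V. r -` {v} - K v)"
    by (auto simp: d_def simp del: UN_simps)
  have "d x = Some v \<longleftrightarrow> r x = v \<and> x \<notin> K v" for x v
    by (auto simp: d_def)
  then have dS: "d -` {Some v} = r -` {v} - K v" for v by auto
  have d: "d -` {w} \<in> F" for w
    using UK K r by (cases w) (auto simp: dN dS)
  have ran: "range d \<subseteq> insert None (Some ` ?V)" by (auto simp: d_def)
  then have "finite (range d)" by (rule finite_subset) (use fin in simp)
  with d have od: "observable d" by (simp add: observable_def)
  have "fibre_entropy m d = (\<Sum>w\<in>insert None (Some ` ?V). eta (m (d -` {w})))"
    using fin ran by (intro fibre_entropy_superset) auto
  also have "\<dots> = eta (m (d -` {None})) + (\<Sum>v\<in>?V. eta (m (d -` {Some v})))"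
    using fin by (subst sum.insert) (auto simp: sum.reindex)
  \<comment> \<open>The frequent value \<open>None\<close> contributes at most 1, by the tangent at
    1. The rare values contribute at most 1 together, by the square root bound and the choice of
    \<delta>.\<close>
  also have "eta (m (d -` {None})) \<le> 1"
    using eta_gibbs[of "m (d -` {None})" 1] nonneg[OF d, of None] by simp
  also have "(\<Sum>v\<in>?V. eta (m (d -` {Some v}))) \<le> (\<Sum>v\<in>?V. 2 * sqrt \<delta>)"
  proof (rule sum_mono)
    fix v assume "v \<in> ?V"
    then have "m (r -` {v} - K v) \<le> \<delta>" using \<delta>(1) by blast
    then have "sqrt (m (d -` {Some v})) \<le> sqrt \<delta>" by (simp add: dS)
    then show "eta (m (d -` {Some v})) \<le> 2 * sqrt \<delta>"
      using eta_le_sqrt[OF nonneg[OF d], of "Some v"] by linarith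
  qed
  also have "(\<Sum>v\<in>?V. 2 * sqrt \<delta>) \<le> 1" using \<delta>(2) by simp
  finally have "fibre_entropy m d \<le> 2" by simp
  moreover have "fibre_entropy m (\<lambda>x. (r x, q x)) \<le> fibre_entropy m (\<lambda>x. (q x, d x))"
    by (rule fibre_entropy_mono[where g = "\<lambda>(u, w). (case u of Some v \<Rightarrow> v | None \<Rightarrow> the w, u)", OF observable_Pair[OF oq od]])
       (auto simp: q_def d_def)
  moreover have "fibre_entropy m (\<lambda>x. (q x, d x)) \<le> fibre_entropy m q + fibre_entropy m d"
    by (rule fibre_entropy_Pair_le[OF oq od])
  ultimately show "fibre_entropy m (\<lambda>x. (r x, q x)) \<le> fibre_entropy m q + 2" by linarith
qed

text \<open>Such a word is determined by the set of positions where it is not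
  \<open>None\<close>.\<close>

lemma card_option_words:
  fixes u :: "nat \<Rightarrow> 'b" and n :: nat
  defines "W \<equiv> {w. length w = n \<and> (\<forall>i<n. w ! i \<in> {None, Some (u i)})}"
  shows "finite W" and "card W \<le> 2 ^ n"
proof -
  let ?g = "\<lambda>A. map (\<lambda>i. if i \<in> A then Some (u i) else None) [0..<n]"
  have sub: "W \<subseteq> ?g ` Pow {..<n}"
  proof
    fix w assume w: "w \<in> W"
    have "w = ?g {i. i < n \<and> w ! i \<noteq> None}"
      by (rule nth_equalityI) (use w in \<open>auto simp: W_def\<close>)
    then show "w \<in> ?g ` Pow {..<n}" by blast
  qed
  then show "finite W" by (rule finite_subset) simp
  have "card W \<le> card (?g ` Pow {..<n})"
    by (rule card_mono[OF _ sub]) simp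
  also have "\<dots> \<le> card (Pow {..<n})" by (rule card_image_le) simp
  finally show "card W \<le> 2 ^ n" by (simp add: card_Pow)
qed

text \<open>Reading length-k itineraries as single letters along \<open>f ^^ k\<close> loses
  nothing. This passes from the map to its k-th iterate.\<close>

lemma concat_itinerary: "concat (itinerary (f ^^ k) (itinerary f p k) n x) = itinerary f p (n * k) x"
proof (induction n)
  case (Suc n)
  have "itinerary (f ^^ k) (itinerary f p k) (Suc n) x
    = itinerary (f ^^ k) (itinerary f p k) n x @ [itinerary f p k ((f ^^ (n * k)) x)]"
    by (simp add: itinerary_def funpow_mult_apply mult.commute)
  moreover have "itinerary f p (Suc n * k) x = itinerary f p (n * k) x @ itinerary f p k ((f ^^ (n * k)) x)"
    by (simp add: itinerary_add flip: add.commute[of "n * k" k])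
  ultimately show ?case using Suc by simp
qed simp

lemma (in invariant_content) invariant_content_funpow: "invariant_content F m (f ^^ k)"
  by unfold_locales (auto intro: funpow_vimage funpow_invariant)

text \<open>A point outside \<open>C\<close> almost surely never enters \<open>C\<close>, so up to a null set its itinerary only
  consists of \<open>None\<close>.\<close>

lemma (in invariant_content) entropy_le_cover_number:
  assumes fC: "f ` C \<subseteq> C" and CF: "C \<in> F"
    and fin: "finite V" and K: "\<And>v. K v \<subseteq> C" "\<And>v. v \<notin> V \<Longrightarrow> K v = {}"
    and q: "observable q" "\<And>v. q -` {Some v} = K v"
    and \<D>: "\<D> \<subseteq> iterated_join C f ((\<lambda>v. C - (\<Union>w\<in>V - {v}. K w)) ` V) (n * k)" "finite \<D>" "\<Union>\<D> = C"
    and k: "k > 0"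
  shows "fibre_entropy m (itinerary (f ^^ k) q n) \<le> ln (1 + card \<D> * 2 ^ n)"
proof -
  interpret g: invariant_content F m "f ^^ k" by (rule invariant_content_funpow)
  let ?it = "itinerary (f ^^ k) q n"
  have "\<exists>u. B = C \<inter> (\<Inter>i<n * k. (f ^^ i) -` (C - (\<Union>w\<in>V - {u i}. K w)))" if B: "B \<in> \<D>" for B
  proof -
    obtain U where U: "B = C \<inter> (\<Inter>i<n * k. (f ^^ i) -` U i)"
      "\<forall>i<n * k. U i \<in> (\<lambda>v. C - (\<Union>w\<in>V - {v}. K w)) ` V"
      using subsetD[OF \<D>(1) B] by (rule iterated_join_E)
    then have "\<forall>i. \<exists>v. i < n * k \<longrightarrow> U i = C - (\<Union>w\<in>V - {v}. K w)" by blast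
    then obtain u where u: "\<And>i. i < n * k \<Longrightarrow> U i = C - (\<Union>w\<in>V - {u i}. K w)" by metis
    show ?thesis
      by (rule exI[of _ u], subst U(1), intro arg_cong2[where f = "(\<inter>)"] INF_cong refl) (simp add: u)
  qed
  then have "\<forall>B\<in>\<D>. \<exists>u. B = C \<inter> (\<Inter>i<n * k. (f ^^ i) -` (C - (\<Union>w\<in>V - {u i}. K w)))" by blast
  from bchoice[OF this] obtain u
    where u: "\<forall>B\<in>\<D>. B = C \<inter> (\<Inter>i<n * k. (f ^^ i) -` (C - (\<Union>w\<in>V - {u B i}. K w)))"
    by (elim exE)
  \<comment> \<open>\<open>q\<close> is observed only at multiples of \<open>k\<close>. At these
    times an orbit starting in \<open>B\<close> can meet no \<open>K w\<close> except the one for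
    \<open>u B (i * k)\<close>, so each observation has two possible outcomes.\<close>
  define W where "W B = {w. length w = n \<and> (\<forall>i<n. w ! i \<in> {None, Some (u B (i * k))})}" for B
  have finW: "finite (W B)" and cardW: "card (W B) \<le> 2 ^ n" for B
    unfolding W_def by (rule card_option_words)+
  \<comment> \<open>The added word belongs to points that stay unlabelled outside \<open>C\<close>;
    it is the 1 in the bound.\<close>
  let ?W = "insert (replicate n None) (\<Union>B\<in>\<D>. W B)"
  have inC: "?it x \<in> ?W" if xC: "x \<in> C" for x
  proof -
    obtain B where B: "B \<in> \<D>" "x \<in> B" using \<D>(3) xC by blast
    have "q ((f ^^ (i * k)) x) \<in> {None, Some (u B (i * k))}" if "i < n" for i
    proof -
      have ik: "i * k < n * k" using that k by simp
      have *: "(f ^^ (i * k)) x \<notin> K w" if "w \<in> V" "w \<noteq> u B (i * k)" for w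
        using bspec[OF u B(1)] B(2) ik that by blast
      show ?thesis
      proof (cases "q ((f ^^ (i * k)) x)")
        case (Some v)
        then have "(f ^^ (i * k)) x \<in> q -` {Some v}" by simp
        then show ?thesis using *[of v] Some K(2)[of v] by (auto simp: q(2))
      qed simp
    qed
    then have "?it x \<in> W B"
      by (auto simp: W_def funpow_mult_apply mult.commute)
    then show ?thesis using B by blast
  qed
  have "m (?it -` {w}) = 0" if w: "w \<notin> ?W" for w
  proof (cases "?it -` {w} = {}")
    case False
    then have len: "length w = n" by auto
    have "\<exists>i<n. w ! i \<noteq> None"
    proof (rule ccontr)
      assume "\<not> ?thesis"
      then have "w = replicate n None" using len by (intro nth_equalityI) auto
      with w show False by blast
    qed
    then obtain i v where i: "i < n" "w ! i = Some v" by blast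
    have sub: "?it -` {w} \<subseteq> ((f ^^ k) ^^ i) -` C - C"
    proof
      fix x assume x: "x \<in> ?it -` {w}"
      then have "q (((f ^^ k) ^^ i) x) = Some v" using i by auto
      then have "((f ^^ k) ^^ i) x \<in> q -` {Some v}" by simp
      then have "((f ^^ k) ^^ i) x \<in> C"
        using K(1)[of v] by (auto simp: q(2))
      moreover have "x \<notin> C" using inC[of x] x w by auto
      ultimately show "x \<in> ((f ^^ k) ^^ i) -` C - C" by simp
    qed
    have F: "((f ^^ k) ^^ i) -` C \<in> F" using CF by (rule g.funpow_vimage)
    \<comment> \<open>\<open>C\<close> lies in its preimage and has the same content, so the points
      that enter \<open>C\<close> from outside have content 0.\<close>
    have "C \<subseteq> ((f ^^ k) ^^ i) -` C"
      using funpow_image_subset[OF fC] by (auto simp: funpow_mult_apply)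
    then have "m (((f ^^ k) ^^ i) -` C - C) = 0"
      using content_Diff[OF F CF] g.funpow_invariant[OF CF] by simp
    moreover have "m (?it -` {w}) \<le> m (((f ^^ k) ^^ i) -` C - C)"
      using sub F CF g.observable_itinerary[OF q(1)] by (intro content_mono) auto
    moreover have "m (?it -` {w}) \<ge> 0"
      using g.observable_itinerary[OF q(1)] by (intro nonneg) auto
    ultimately show ?thesis by linarith
  qed simp
  then have "fibre_entropy m ?it \<le> ln (card ?W)"
    using \<D>(2) finW by (intro fibre_entropy_le_ln_card g.observable_itinerary q(1)) auto
  also have "card ?W \<le> 1 + card \<D> * 2 ^ n"
  proof -
    have "card (\<Union>B\<in>\<D>. W B) \<le> (\<Sum>B\<in>\<D>. card (W B))"
      by (rule card_UN_le[OF \<D>(2)])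
    also have "\<dots> \<le> (\<Sum>B\<in>\<D>. 2 ^ n)" by (intro sum_mono cardW)
    finally have "card (\<Union>B\<in>\<D>. W B) \<le> card \<D> * 2 ^ n" by simp
    moreover have "card ?W \<le> Suc (card (\<Union>B\<in>\<D>. W B))"
      by (rule card_insert_le_m1) auto
    ultimately show ?thesis by simp
  qed
  then have "ln (card ?W) \<le> ln (1 + card \<D> * 2 ^ n)"
    using \<D>(2) finW by (subst ln_le_cancel_iff) (auto simp: card_gt_0_iff simp flip: of_nat_Suc of_nat_mult of_nat_power)
  finally show ?thesis .
qed

lemma radon_measure_inner_compact:
  assumes "prob_space \<mu>" "radon_measure \<mu>" "A \<in> sets \<mu>" "\<delta> > 0"
  shows "\<exists>K. compact K \<and> K \<subseteq> A \<and> measure \<mu> A - measure \<mu> K < \<delta>"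
proof (rule ccontr)
  interpret prob_space \<mu> by fact
  assume "\<not> ?thesis"
  then have *: "measure \<mu> A - measure \<mu> K \<ge> \<delta>" if "compact K" "K \<subseteq> A" for K
    using that by (metis not_less)
  have "emeasure \<mu> A = (SUP K\<in>{K. compact K \<and> K \<subseteq> A}. emeasure \<mu> K)"
    using assms unfolding radon_measure_def by blast
  also have "\<dots> \<le> ennreal (measure \<mu> A - \<delta>)"
    using * by (intro SUP_least) (force simp: emeasure_eq_measure intro!: ennreal_leI)
  finally have "ennreal (measure \<mu> A) \<le> ennreal (measure \<mu> A - \<delta>)"
    by (simp add: emeasure_eq_measure)
  \<comment> \<open>\<open>ennreal\<close> truncates negative numbers to 0, so the difference has to
    be nonnegative before the inequality can be read over the reals; the empty compact set shows
    this.\<close>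
  moreover have "measure \<mu> A \<ge> \<delta>"
    using *[of "{}"] by simp
  ultimately have "measure \<mu> A \<le> measure \<mu> A - \<delta>"
    by (subst (asm) ennreal_le_iff) auto
  then show False using assms by linarith
qed

lemma ln_cover_words_le: "ln (1 + real N * 2 ^ n) \<le> 1 + real n + ln N"
proof (cases "N = 0")
  case False
  then have N: "real N \<ge> 1" by simp
  then have "1 \<le> real N * 2 ^ n"
    using mult_mono[of 1 "real N" 1 "2 ^ n"] by simp
  then have "ln (1 + real N * 2 ^ n) \<le> ln (2 ^ Suc n * real N)"
    by (intro ln_mono) (auto simp: algebra_simps add_pos_nonneg)
  also have "\<dots> = Suc n * ln 2 + ln N"
    using N by (subst ln_mult) (auto simp: ln_realpow simp del: power_Suc)
  also have "\<dots> \<le> Suc n * 1 + ln N"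
    using ln_2_less_1 by (intro add_mono mult_left_mono) auto
  finally show ?thesis by simp
qed simp

lemma invariant_content_measure:
  fixes \<psi> :: "'a::metric_space \<Rightarrow> 'a"
  assumes "prob_space \<mu>" "sets \<mu> = sets borel" "invariant_measure \<mu> \<psi>" "continuous_on UNIV \<psi>"
  shows "invariant_content (sets \<mu>) (measure \<mu>) \<psi>"
proof -
  have sp: "space \<mu> = UNIV"
    using sets_eq_imp_space_eq[OF assms(2)] by simp
  interpret prob_content "sets \<mu>" "measure \<mu>"
    by (rule prob_content_measure[OF assms(1) sp])
  show ?thesis
  proof unfold_locales
    fix A assume A: "A \<in> sets \<mu>"
    have "\<psi> \<in> borel_measurable borel"
      using assms(4) by (rule borel_measurable_continuous_onI)
    then show "\<psi> -` A \<in> sets \<mu>"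
      using A assms(2) measurable_sets[of \<psi> borel borel A] by simp
    show "measure \<mu> (\<psi> -` A) = measure \<mu> A"
      using assms(3) A sp by (simp add: invariant_measure_def measure_def)
  qed
qed

text \<open>Working with \<open>\<psi> ^^ k\<close> pays the constant 3 only once in
  \<open>k\<close> steps. The compact sets are chosen before \<open>l\<close>, and the threshold for
  \<open>l\<close> comes from continuity of the measure along the \<open>C l\<close>. If the left
  side is negative, \<open>ennreal\<close> turns it into 0.\<close>

lemma KS_entropy_le_topological_entropy:
  fixes \<psi> :: "'a::metric_space \<Rightarrow> 'a"
  assumes \<mu>: "prob_space \<mu>" "radon_measure \<mu>" "invariant_measure \<mu> \<psi>"
    and cont: "continuous_on UNIV \<psi>"
    and P: "finite_measurable_partition \<mu> \<P>"
    and C: "(\<Union>l. C l) = UNIV" "\<And>l. compact (C l)" "\<And>l. \<psi> ` C l \<subseteq> C l" "\<And>l. C l \<subseteq> C (Suc l)"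
    and k: "k > 0"
  shows "\<forall>\<^sub>F l in sequentially. ennreal (KS_entropy_partition \<mu> \<psi> \<P> - 3 / real k)
    \<le> topological_entropy (top_of_set (C l)) (restrict \<psi> (C l))"
proof -
  interpret prob_space \<mu> by fact
  have sets_\<mu>: "sets \<mu> = sets borel" using \<mu>(2) by (simp add: radon_measure_def)
  then have sp: "space \<mu> = UNIV" using sets_eq_imp_space_eq[OF sets_\<mu>] by simp
  interpret invariant_content "sets \<mu>" "measure \<mu>" \<psi>
    by (rule invariant_content_measure) (use \<mu> sets_\<mu> cont in auto)
  interpret g: invariant_content "sets \<mu>" "measure \<mu>" "\<psi> ^^ k"
    by (rule invariant_content_funpow)
  obtain p :: "'a \<Rightarrow> 'a set" where p: "observable p" "\<P> = (\<lambda>v. p -` {v}) ` range p"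
    using finite_measurable_partition_fibres[OF \<mu>(1) sp P] .
  define H where "H n = fibre_entropy (measure \<mu>) (itinerary \<psi> p n)" for n
  define h where "h = KS_entropy_partition \<mu> \<psi> \<P>"
  have h: "n * h \<le> H n" if "n \<ge> 1" for n
    using fekete_lim(2)[of H n] that entropy_itinerary_nonneg[OF p(1)] entropy_itinerary_subadditive[OF p(1)]
    by (simp add: h_def KS_entropy_partition_def p(2) partition_entropy_fibres[OF sp observable_finite[OF p(1)]]
      flip: H_def)
  define r where "r = itinerary \<psi> p k"
  have r: "observable r" unfolding r_def by (rule observable_itinerary[OF p(1)])
  let ?V = "range r"
  have fin: "finite ?V" using r by (rule observable_finite)
  define c where "c = real (card ?V)"
  have c: "c > 0" using fin by (auto simp: c_def card_gt_0_iff)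
  \<comment> \<open>Chosen so that \<open>c\<close> cells of content at most \<delta> have total
    entropy at most \<open>c * (2 * sqrt \<delta>) = 1\<close>.\<close>
  define \<delta> where "\<delta> = (1 / (2 * c))\<^sup>2"
  have \<delta>: "\<delta> > 0" "c * (2 * sqrt \<delta>) \<le> 1" using c by (auto simp: \<delta>_def real_sqrt_divide)
  have "\<exists>K. compact K \<and> K \<subseteq> r -` {v} \<and> measure \<mu> (r -` {v}) - measure \<mu> K < \<delta> / 2" for v
    by (rule radon_measure_inner_compact[OF \<mu>(1,2) observable_fibre[OF r]]) (use \<delta> in simp)
  then obtain K' where K': "\<And>v. compact (K' v)" "\<And>v. K' v \<subseteq> r -` {v}"
      "\<And>v. measure \<mu> (r -` {v}) - measure \<mu> (K' v) < \<delta> / 2"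
    by metis
  have C_sets: "C l \<in> sets \<mu>" and K'_sets: "K' v \<in> sets \<mu>" for l v
    using C(2) K'(1) sets_\<mu> by (auto intro: borel_compact)
  have "\<forall>\<^sub>F l in sequentially. measure \<mu> (K' v) - \<delta> / 2 < measure \<mu> (K' v \<inter> C l)" for v
  proof -
    have "(\<lambda>l. measure \<mu> (K' v \<inter> C l)) \<longlonglongrightarrow> measure \<mu> (\<Union>l. K' v \<inter> C l)"
      using C(4) C_sets K'_sets by (intro finite_Lim_measure_incseq) (auto simp: incseq_Suc_iff)
    moreover have "(\<Union>l. K' v \<inter> C l) = K' v" using C(1) by blast
    ultimately have "(\<lambda>l. measure \<mu> (K' v \<inter> C l)) \<longlonglongrightarrow> measure \<mu> (K' v)" by simp
    then show ?thesis by (rule order_tendstoD) (use \<delta> in simp)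
  qed
  then have "\<forall>\<^sub>F l in sequentially. \<forall>v\<in>?V. measure \<mu> (K' v) - \<delta> / 2 < measure \<mu> (K' v \<inter> C l)"
    using fin by (intro eventually_ball_finite) auto
  then show ?thesis
  proof eventually_elim
    case (elim l)
    \<comment> \<open>A compact set need not lie in any single \<open>C l\<close>, so it is cut
      down. For large \<open>l\<close> this loses at most another \<delta> / 2.\<close>
    define K where "K v = K' v \<inter> C l" for v
    have K_sets: "K v \<in> sets \<mu>" for v using C_sets K'_sets by (auto simp: K_def)
    have K_sub: "K v \<subseteq> r -` {v}" for v using K'(2)[of v] by (auto simp: K_def)
    have K_closed: "closed (K v)" for v
      unfolding K_def using K'(1) C(2) by (intro closed_Int compact_imp_closed) auto
    have K_small: "\<forall>v\<in>?V. measure \<mu> (r -` {v} - K v) \<le> \<delta>"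
    proof
      fix v assume "v \<in> ?V"
      then have "measure \<mu> (K' v) - \<delta> / 2 < measure \<mu> (K v)"
        unfolding K_def using elim by blast
      then show "measure \<mu> (r -` {v} - K v) \<le> \<delta>"
        using K'(3)[of v] content_Diff[OF observable_fibre[OF r] K_sets K_sub, of v] by linarith
    qed
    define q where "q x = (if x \<in> K (r x) then Some (r x) else None)" for x
    note trunc = entropy_truncated_label[OF r K_sets K_sub K_small \<delta>(2)[unfolded c_def], folded q_def]
    define \<U> where "\<U> = (\<lambda>v. C l - (\<Union>w\<in>?V - {v}. K w)) ` ?V"
    have "openin (top_of_set (C l)) (C l - (\<Union>w\<in>?V - {v}. K w))" for v
      unfolding openin_open
      by (rule exI[of _ "- (\<Union>w\<in>?V - {v}. K w)"])
         (use fin K_closed in \<open>auto intro!: closed_UN\<close>)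
    moreover have "\<Union>\<U> = C l"
    proof
      show "C l \<subseteq> \<Union>\<U>"
      proof
        fix x assume "x \<in> C l"
        moreover have "x \<notin> K w" if "w \<noteq> r x" for w
          using K_sub[of w] that by auto
        ultimately have "x \<in> C l - (\<Union>w\<in>?V - {r x}. K w)" by blast
        then show "x \<in> \<Union>\<U>" unfolding \<U>_def by blast
      qed
    qed (auto simp: \<U>_def)
    ultimately have adm: "admissible_cover (top_of_set (C l)) \<U>"
      unfolding admissible_cover_compact[OF C(2)] by (auto simp: \<U>_def)
    define T where "T = topological_entropy_cover (top_of_set (C l)) (restrict \<psi> (C l)) \<U>"
    define N where "N n = cover_number (C l) (iterated_join (C l) \<psi> \<U> n)" for n
    have T: "(\<lambda>n. 1 / n * ln (N n)) \<longlonglongrightarrow> T"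
      unfolding N_def T_def by (rule topological_entropy_cover_tendsto[OF C(2,3) adm])
    \<comment> \<open>Of the \<open>3 * n\<close>, two thirds bound n H(r|q) and one third the
      logarithm of the 2^n words per member of the subcover; the 1 absorbs the additional
      word.\<close>
    have main: "(n * k) * h \<le> 1 + 3 * n + ln (N (n * k))" if n: "n \<ge> 1" for n
    proof -
      obtain \<B> where \<B>: "\<B> \<subseteq> \<U>" "finite \<B>" "\<Union>\<B> = C l"
        using admissible_finite_subcover[OF C(2) adm] .
      obtain \<D>\<^sub>0 where "\<D>\<^sub>0 \<subseteq> iterated_join (C l) \<psi> \<U> (n * k)" "finite \<D>\<^sub>0" "\<Union>\<D>\<^sub>0 = C l"
        using finite_subcover_iterated_join[OF C(3) \<B>] .
      then obtain \<D> where \<D>: "\<D> \<subseteq> iterated_join (C l) \<psi> \<U> (n * k)" "finite \<D>" "\<Union>\<D> = C l" "card \<D> = N (n * k)"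
        unfolding N_def by (rule cover_number_attained)
      have K_C: "K v \<subseteq> C l" for v by (simp add: K_def)
      have K_empty: "K v = {}" if "v \<notin> ?V" for v using K_sub[of v] that by auto
      have "(n * k) * h \<le> H (n * k)" using h[of "n * k"] n k by simp
      also have "H (n * k) \<le> fibre_entropy (measure \<mu>) (itinerary (\<psi> ^^ k) r n)"
        unfolding H_def r_def concat_itinerary[symmetric]
        by (rule fibre_entropy_mono[OF g.observable_itinerary[OF r[unfolded r_def]] refl])
      also have "\<dots> \<le> fibre_entropy (measure \<mu>) (itinerary (\<psi> ^^ k) q n)
          + n * (fibre_entropy (measure \<mu>) (\<lambda>x. (r x, q x)) - fibre_entropy (measure \<mu>) q)"
        by (rule g.entropy_itinerary_conditional[OF r trunc(1)])
      also have "\<dots> \<le> fibre_entropy (measure \<mu>) (itinerary (\<psi> ^^ k) q n) + real n * 2"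
        using trunc(3) by (intro add_left_mono mult_left_mono of_nat_0_le_iff) linarith
      also have "fibre_entropy (measure \<mu>) (itinerary (\<psi> ^^ k) q n) \<le> ln (1 + card \<D> * 2 ^ n)"
        by (rule entropy_le_cover_number[OF C(3) C_sets fin K_C K_empty trunc(1,2) \<D>(1)[unfolded \<U>_def] \<D>(2,3) k])
      also have "\<dots> \<le> 1 + n + ln (N (n * k))"
        using ln_cover_words_le[of "card \<D>" n] by (simp add: \<D>(4))
      finally show ?thesis by simp
    qed
    have "strict_mono (\<lambda>n. n * k)" using k by (simp add: strict_mono_def)
    then have "(\<lambda>n. 1 / (n * k)) \<longlonglongrightarrow> 0" "(\<lambda>n. 1 / (n * k) * ln (N (n * k))) \<longlonglongrightarrow> T"
      using LIMSEQ_subseq_LIMSEQ[OF lim_1_over_n] LIMSEQ_subseq_LIMSEQ[OF T] by (fastforce simp: o_def)+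
    then have "(\<lambda>n. 1 / (n * k) + 3 / k + 1 / (n * k) * ln (N (n * k))) \<longlonglongrightarrow> 0 + 3 / k + T"
      by (intro tendsto_intros)
    moreover have "h \<le> 1 / (n * k) + 3 / k + 1 / (n * k) * ln (N (n * k))" if "n \<ge> 1" for n
      using main[OF that] that k by (simp add: field_simps)
    ultimately have "h \<le> 0 + 3 / k + T"
      by (intro LIMSEQ_le_const) auto
    then have "ennreal (h - 3 / k) \<le> ennreal T" by (intro ennreal_leI) simp
    also have "\<dots> \<le> topological_entropy (top_of_set (C l)) (restrict \<psi> (C l))"
      unfolding topological_entropy_def T_def using adm by (intro SUP_upper) simp
    finally show ?case by (simp add: h_def)
  qed
qed

subsection \<open>Radon measures from finitely additive contents\<close>

locale topological_content = prob_content F m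
  for F :: "'a::metric_space set set" and m +
  assumes open_in_F: "open U \<Longrightarrow> U \<in> F"
begin

lemma closed_in_F: "closed K \<Longrightarrow> K \<in> F"
  using open_in_F[of "- K"] compl_sets[of "- K"] by (simp add: open_Compl Compl_eq_Diff_UNIV[symmetric])

text \<open>An analogue of Jordan measurability. Since \<open>K\<close> and \<open>U\<close> may
  vary with \<open>e\<close>, the boundary itself need not be small, and for a Borel probability
  every Borel set qualifies. Borel measurability is demanded separately because \<open>F\<close> may
  be the power set.\<close>

definition jordan_sets :: "'a set set" where
  "jordan_sets = {A \<in> F \<inter> sets borel. \<forall>e>0. \<exists>K U. closed K \<and> open U \<and> K \<subseteq> A \<and> A \<subseteq> U \<and> m (U - K) < e}"

lemma jordan_sets_I:
  assumes "A \<in> F" "A \<in> sets borel"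
    and "\<And>e. e > 0 \<Longrightarrow> \<exists>K U. closed K \<and> open U \<and> K \<subseteq> A \<and> A \<subseteq> U \<and> m (U - K) < e"
  shows "A \<in> jordan_sets"
  using assms by (simp add: jordan_sets_def)

lemma jordan_sets_E:
  assumes "A \<in> jordan_sets" "e > 0"
  obtains K U where "closed K" "open U" "K \<subseteq> A" "A \<subseteq> U" "m (U - K) < e"
  using assms unfolding jordan_sets_def by blast

lemma algebra_jordan_sets: "algebra UNIV jordan_sets"
  unfolding algebra_iff_Un
proof (intro conjI ballI)
  show "{} \<in> jordan_sets"
    by (rule jordan_sets_I) (auto intro!: exI[of _ "{}"])
next
  fix A assume A: "A \<in> jordan_sets"
  show "UNIV - A \<in> jordan_sets"
  proof (rule jordan_sets_I)
    fix e :: real assume "e > 0"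
    with A obtain K U where "closed K" "open U" "K \<subseteq> A" "A \<subseteq> U" "m (U - K) < e"
      by (rule jordan_sets_E)
    moreover have "(- K) - (- U) = U - K" by auto
    ultimately show "\<exists>K U. closed K \<and> open U \<and> K \<subseteq> UNIV - A \<and> UNIV - A \<subseteq> U \<and> m (U - K) < e"
      by (intro exI[of _ "- U"] exI[of _ "- K"]) auto
  qed (use A in \<open>auto simp: jordan_sets_def\<close>)
next
  fix A B assume A: "A \<in> jordan_sets" and B: "B \<in> jordan_sets"
  show "A \<union> B \<in> jordan_sets"
  proof (rule jordan_sets_I)
    fix e :: real assume e: "e > 0"
    obtain K U where KU: "closed K" "open U" "K \<subseteq> A" "A \<subseteq> U" "m (U - K) < e / 2"
      using jordan_sets_E[OF A half_gt_zero[OF e]] .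
    obtain L V where LV: "closed L" "open V" "L \<subseteq> B" "B \<subseteq> V" "m (V - L) < e / 2"
      using jordan_sets_E[OF B half_gt_zero[OF e]] .
    have "U \<in> F" "V \<in> F" "K \<in> F" "L \<in> F"
      using KU LV by (simp_all add: open_in_F closed_in_F)
    then have F: "U - K \<in> F" "V - L \<in> F" "(U \<union> V) - (K \<union> L) \<in> F" by auto
    have "m ((U \<union> V) - (K \<union> L)) \<le> m ((U - K) \<union> (V - L))"
      using F by (intro content_mono) auto
    also have "\<dots> \<le> m (U - K) + m (V - L)"
      using F by (intro content_Un_le) auto
    also have "\<dots> < e" using KU LV by simp
    finally show "\<exists>K U. closed K \<and> open U \<and> K \<subseteq> A \<union> B \<and> A \<union> B \<subseteq> U \<and> m (U - K) < e"
      using KU LV by (intro exI[of _ "K \<union> L"] exI[of _ "U \<union> V"]) auto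
  qed (use A B in \<open>auto simp: jordan_sets_def\<close>)
qed simp

text \<open>The content of superlevel sets is monotone in the threshold, hence discontinuous at only
  countably many thresholds. At a point of continuity the open set is approximated from inside by
  closed superlevel sets with slightly larger threshold.\<close>

lemma jordan_superlevel:
  fixes f :: "'a \<Rightarrow> real"
  assumes f: "continuous_on UNIV f"
  shows "countable {t. {x. t < f x} \<notin> jordan_sets}"
proof -
  have op: "open {x. t < f x}" and cl: "closed {x. t \<le> f x}" for t
    by (rule open_Collect_less closed_Collect_le, intro continuous_on_const, rule f)+
  define G where "G t = - m {x. t < f x}" for t
  have mono: "mono G"
    unfolding G_def by (intro monoI le_imp_neg_le content_mono open_in_F op) auto
  have "{x. t < f x} \<in> jordan_sets" if isC: "isCont G t" for t
  proof (rule jordan_sets_I)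
    show "{x. t < f x} \<in> F" "{x. t < f x} \<in> sets borel"
      using op by (auto intro: open_in_F)
    fix e :: real assume "e > 0"
    then obtain d where d: "d > 0" "\<And>s. dist s t < d \<Longrightarrow> dist (G s) (G t) < e"
      using isC unfolding continuous_at_eps_delta by metis
    let ?s = "t + d / 2"
    have "m ({x. t < f x} - {x. ?s \<le> f x}) \<le> m ({x. t < f x} - {x. ?s < f x})"
      by (intro content_mono Diff open_in_F closed_in_F op cl) auto
    also have "\<dots> = G ?s - G t"
      using d by (subst content_Diff) (auto simp: G_def intro!: open_in_F op)
    also have "\<dots> < e" using d(2)[of ?s] d(1) by (simp add: dist_real_def)
    finally show "\<exists>K U. closed K \<and> open U \<and> K \<subseteq> {x. t < f x} \<and> {x. t < f x} \<subseteq> U \<and> m (U - K) < e"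
      using d(1) by (intro exI[of _ "{x. ?s \<le> f x}"] exI[of _ "{x. t < f x}"] conjI cl op) auto
  qed
  then have "{t. {x. t < f x} \<notin> jordan_sets} \<subseteq> {t. \<not> isCont G t}" by blast
  then show ?thesis
    using mono_ctble_discont[OF mono] countable_subset by blast
qed

lemma jordan_superlevel_between:
  fixes f :: "'a \<Rightarrow> real"
  assumes "continuous_on UNIV f" "a < b"
  obtains t where "a < t" "t < b" "{x. t < f x} \<in> jordan_sets"
proof -
  have "\<not> {a<..<b} \<subseteq> {t. {x. t < f x} \<notin> jordan_sets}"
    using jordan_superlevel[OF assms(1)] uncountable_open_interval[of a b] assms(2) countable_subset by blast
  then show ?thesis using that by auto
qed

text \<open>An open set is where the distance to its complement is positive; exhaust it by Jordan
  superlevel sets with thresholds tending to 0.\<close>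

lemma open_eq_UN_jordan:
  assumes "open U"
  obtains A :: "nat \<Rightarrow> 'a set" where "\<And>n. A n \<in> jordan_sets" "U = (\<Union>n. A n)"
proof (cases "U = UNIV")
  \<comment> \<open>The distance to an empty complement is 0 by convention, so the whole space is
    treated apart.\<close>
  case True
  interpret J: algebra UNIV jordan_sets by (rule algebra_jordan_sets)
  show ?thesis using that[of "\<lambda>_. UNIV"] True by auto
next
  case False
  define f where "f x = infdist x (- U)" for x
  have f: "continuous_on UNIV f" unfolding f_def by (intro continuous_intros)
  have U: "x \<in> U \<longleftrightarrow> f x > 0" for x
  proof -
    have "f x = 0 \<longleftrightarrow> x \<in> - U"
      unfolding f_def using assms False by (intro in_closed_iff_infdist_zero[symmetric]) auto
    then show ?thesis using infdist_nonneg[of x "- U"] by (auto simp: f_def)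
  qed
  have "\<exists>t. 0 < t \<and> t < 1 / real (Suc n) \<and> {x. t < f x} \<in> jordan_sets" for n
    using jordan_superlevel_between[OF f, of 0 "1 / real (Suc n)"] by auto
  then obtain t where t: "\<And>n. 0 < t n" "\<And>n. t n < 1 / real (Suc n)" "\<And>n. {x. t n < f x} \<in> jordan_sets"
    by metis
  have "U = (\<Union>n. {x. t n < f x})"
  proof
    show "U \<subseteq> (\<Union>n. {x. t n < f x})"
    proof
      fix x assume "x \<in> U"
      then have "f x > 0" using U by simp
      then obtain n where "1 / real (Suc n) < f x"
        using nat_approx_posE by metis
      then have "t n < f x" using t(2)[of n] by linarith
      then show "x \<in> (\<Union>n. {x. t n < f x})" by blast
    qed
    show "(\<Union>n. {x. t n < f x}) \<subseteq> U"
    proof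
      fix x assume "x \<in> (\<Union>n. {x. t n < f x})"
      then obtain n where "t n < f x" by blast
      then show "x \<in> U" using t(1)[of n] U by auto
    qed
  qed
  then show ?thesis by (rule that[OF t(3)])
qed

lemma sigma_sets_jordan: "sigma_sets UNIV jordan_sets = sets borel"
proof
  show "sigma_sets UNIV jordan_sets \<subseteq> sets borel"
    using sets.sigma_sets_subset[of jordan_sets borel] by (auto simp: jordan_sets_def)
  have "U \<in> sigma_sets UNIV jordan_sets" if U: "open U" for U
  proof -
    obtain A :: "nat \<Rightarrow> 'a set" where "\<And>n. A n \<in> jordan_sets" "U = (\<Union>n. A n)"
      using open_eq_UN_jordan[OF U] by blast
    then show ?thesis by (auto intro!: sigma_sets.Union)
  qed
  then have "sigma_sets UNIV {U. open U} \<subseteq> sigma_sets UNIV jordan_sets"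
    by (intro sigma_sets_mono) auto
  then show "sets borel \<subseteq> sigma_sets UNIV jordan_sets"
    by (simp add: borel_def)
qed

end

text \<open>This is the regularity of Borel probability measures on metric spaces.\<close>

lemma borel_jordan_sets:
  fixes \<mu> :: "'a::metric_space measure"
  assumes "prob_space \<mu>" "sets \<mu> = sets borel"
  shows "topological_content (sets \<mu>) (measure \<mu>)"
    and "topological_content.jordan_sets (sets \<mu>) (measure \<mu>) = sets borel"
proof -
  interpret prob_space \<mu> by fact
  have sp: "space \<mu> = UNIV" using sets_eq_imp_space_eq[OF assms(2)] by simp
  interpret prob_content "sets \<mu>" "measure \<mu>"
    by (rule prob_content_measure[OF assms(1) sp])
  show "topological_content (sets \<mu>) (measure \<mu>)"
    by unfold_locales (simp add: assms)
  then interpret topological_content "sets \<mu>" "measure \<mu>" .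
  interpret J: algebra UNIV jordan_sets by (rule algebra_jordan_sets)
  have "A \<in> jordan_sets" if "A \<in> sigma_sets UNIV jordan_sets" for A
    using that
  proof (induction rule: sigma_sets.induct)
    case (Union A)
    show ?case
    proof (rule jordan_sets_I)
      have "A i \<in> sets \<mu>" for i
        using Union.IH[of i] by (simp add: jordan_sets_def)
      then show "(\<Union>i. A i) \<in> sets \<mu>" by auto
      then show "(\<Union>i. A i) \<in> sets borel" by (simp add: assms)
      fix e :: real assume e: "e > 0"
      \<comment> \<open>The errors sum to e / 2, which leaves room for the strict
        inequality.\<close>
      let ?e = "\<lambda>i. e / 2 * (1 / 2) ^ Suc i"
      have "\<exists>K U. closed K \<and> open U \<and> K \<subseteq> A i \<and> A i \<subseteq> U \<and> measure \<mu> (U - K) < ?e i" for i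
      proof -
        have "A i \<in> jordan_sets" "?e i > 0" using Union.IH e by auto
        then show ?thesis using jordan_sets_E by metis
      qed
      then obtain K U where KU: "\<And>i. closed (K i)" "\<And>i. open (U i)" "\<And>i. K i \<subseteq> A i" "\<And>i. A i \<subseteq> U i"
          "\<And>i. measure \<mu> (U i - K i) < ?e i"
        by metis
      have UK_sets: "U i \<in> sets \<mu>" "K i \<in> sets \<mu>" for i
        using KU assms by auto
      have sums: "?e sums (e / 2)"
        using sums_mult[OF power_half_series, of "e / 2"] by simp
      have summ: "summable (\<lambda>i. measure \<mu> (U i - K i))"
        by (rule summable_comparison_test[OF _ sums_summable[OF sums]])
           (use KU(5) in \<open>auto intro!: exI[of _ 0] less_imp_le\<close>)
      have "measure \<mu> ((\<Union>i. U i) - (\<Union>i. K i)) \<le> measure \<mu> (\<Union>i. U i - K i)"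
        using UK_sets by (intro finite_measure_mono) auto
      also have "\<dots> \<le> (\<Sum>i. measure \<mu> (U i - K i))"
        using UK_sets summ by (intro finite_measure_subadditive_countably) auto
      also have "\<dots> \<le> (\<Sum>i. ?e i)"
        using KU(5) by (intro suminf_le summ sums_summable[OF sums] less_imp_le)
      also have "\<dots> = e / 2" using sums by (rule sums_unique[symmetric])
      finally have small: "measure \<mu> ((\<Union>i. U i) - (\<Union>i. K i)) < e" using e by simp
      \<comment> \<open>The union of all \<open>K i\<close> need not be closed. Continuity of the
        measure from above replaces it by a finite union.\<close>
      have "(\<lambda>n. measure \<mu> ((\<Union>i. U i) - (\<Union>i\<le>n. K i)))
          \<longlonglongrightarrow> measure \<mu> (\<Inter>n. (\<Union>i. U i) - (\<Union>i\<le>n. K i))"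
        using UK_sets by (intro finite_Lim_measure_decseq) (auto simp: decseq_def)
      also have "(\<Inter>n. (\<Union>i. U i) - (\<Union>i\<le>n. K i)) = (\<Union>i. U i) - (\<Union>i. K i)" by auto
      finally have "\<forall>\<^sub>F n in sequentially. measure \<mu> ((\<Union>i. U i) - (\<Union>i\<le>n. K i)) < e"
        using small by (rule order_tendstoD)
      then obtain n where n: "measure \<mu> ((\<Union>i. U i) - (\<Union>i\<le>n. K i)) < e"
        by (auto simp: eventually_sequentially)
      have "closed (\<Union>i\<le>n. K i)" "open (\<Union>i. U i)"
        using KU by (auto intro!: closed_UN)
      moreover have "(\<Union>i\<le>n. K i) \<subseteq> (\<Union>i. A i)" "(\<Union>i. A i) \<subseteq> (\<Union>i. U i)"
        using KU(3,4) by blast+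
      ultimately show "\<exists>K U. closed K \<and> open U \<and> K \<subseteq> (\<Union>i. A i) \<and> (\<Union>i. A i) \<subseteq> U \<and> measure \<mu> (U - K) < e"
        using n by blast
    qed
  qed auto
  then show "jordan_sets = sets borel"
    unfolding sigma_sets_jordan by (auto simp: jordan_sets_def)
qed

section \<open>Radon measures carried by a compact set\<close>

lemma radon_measure_compact_support:
  fixes \<mu> :: "'a::metric_space measure"
  assumes "prob_space \<mu>" "sets \<mu> = sets borel" "compact C" "measure \<mu> C = 1"
  shows "radon_measure \<mu>"
  unfolding radon_measure_def
proof (intro conjI allI ballI)
  interpret prob_space \<mu> by fact
  interpret topological_content "sets \<mu>" "measure \<mu>" by (rule borel_jordan_sets[OF assms(1,2)])
  show "sets \<mu> = sets borel" by fact
  show "\<exists>U. open U \<and> x \<in> U \<and> emeasure \<mu> U < \<infinity>" for x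
    by (rule exI[of _ UNIV]) (simp add: emeasure_eq_measure)
  fix A assume A: "A \<in> sets \<mu>"
  show "emeasure \<mu> A = (SUP K\<in>{K. compact K \<and> K \<subseteq> A}. emeasure \<mu> K)" (is "_ = ?S")
  proof (rule antisym)
    show "?S \<le> emeasure \<mu> A"
      using A by (intro SUP_least emeasure_mono) auto
    show "emeasure \<mu> A \<le> ?S"
    proof (rule ennreal_le_epsilon)
      fix e :: real assume e: "e > 0"
      have "A \<in> jordan_sets" using A assms(2) borel_jordan_sets(2)[OF assms(1,2)] by simp
      then obtain K U where K: "closed K" "open U" "K \<subseteq> A" "A \<subseteq> U" "measure \<mu> (U - K) < e"
        using e by (rule jordan_sets_E)
      have F: "U \<in> sets \<mu>" "K \<in> sets \<mu>" "C \<in> sets \<mu>"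
        using K assms by (auto intro: borel_compact)
      have F_C: "- C \<in> sets \<mu>"
        using compl_sets[OF F(3)] by (simp add: Compl_eq_Diff_UNIV)
      have "measure \<mu> (- C) = 0"
        using content_Diff[of UNIV C] F(3) total assms(4) by (simp add: Compl_eq_Diff_UNIV)
      moreover have "measure \<mu> A \<le> measure \<mu> ((K \<inter> C) \<union> ((U - K) \<union> (- C)))"
        using A F F_C K by (intro content_mono Un Int Diff) auto
      moreover have "measure \<mu> ((K \<inter> C) \<union> ((U - K) \<union> (- C)))
          \<le> measure \<mu> (K \<inter> C) + measure \<mu> ((U - K) \<union> (- C))"
        using F F_C by (intro content_Un_le Un Int Diff)
      moreover have "measure \<mu> ((U - K) \<union> (- C)) \<le> measure \<mu> (U - K) + measure \<mu> (- C)"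
        using F F_C by (intro content_Un_le Un Int Diff)
      ultimately have "measure \<mu> A \<le> measure \<mu> (K \<inter> C) + e" using K(5) by linarith
      then have "emeasure \<mu> A \<le> emeasure \<mu> (K \<inter> C) + ennreal e"
        using e by (simp add: emeasure_eq_measure flip: ennreal_plus)
      moreover have "emeasure \<mu> (K \<inter> C) \<le> ?S"
        using K assms(3) by (intro SUP_upper) (auto intro: closed_Int_compact)
      ultimately show "emeasure \<mu> A \<le> ?S + ennreal e"
        by (meson add_right_mono order_trans)
    qed
  qed
qed

text \<open>On the algebra of Jordan sets a tight finitely additive content is continuous at \<open>{}\<close>, by
  compactness; Caratheodory's theorem then makes it countably additive.\<close>

locale tight_content = topological_content "UNIV :: 'a::metric_space set set" m for m +
  fixes C :: "'a set"
  assumes compact_C: "compact C" and content_C: "m C = 1"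
begin

lemma content_Compl_C: "m (- C) = 0"
  using content_Diff[of UNIV C] total content_C by (simp add: Compl_eq_Diff_UNIV)

text \<open>Closed inner approximations of the \<open>A i\<close>, cut down to \<open>C\<close>, are
  compact with empty intersection, so finitely many already have none in common. From there on
  \<open>A j\<close> lies in the complement of \<open>C\<close> and the approximation
  errors.\<close>

lemma content_tendsto_0:
  assumes A: "range A \<subseteq> jordan_sets" "decseq A" "(\<Inter>i. A i) = {}"
  shows "(\<lambda>i. m (A i)) \<longlonglongrightarrow> 0"
proof (rule LIMSEQ_I)
  fix e :: real assume e: "e > 0"
  \<comment> \<open>Every finite sum of these errors stays strictly below \<open>e\<close>.\<close>
  let ?e = "\<lambda>i. e * (1 / 2) ^ Suc i"
  have "\<exists>K U. closed K \<and> open U \<and> K \<subseteq> A i \<and> A i \<subseteq> U \<and> m (U - K) < ?e i" for i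
  proof -
    have "A i \<in> jordan_sets" "?e i > 0" using A(1) e by auto
    then show ?thesis using jordan_sets_E by metis
  qed
  then obtain K U where KU: "\<And>i. closed (K i)" "\<And>i. K i \<subseteq> A i" "\<And>i. A i \<subseteq> U i"
      "\<And>i. m (U i - K i) < ?e i"
    by metis
  have small: "m (A i - K i) \<le> ?e i" for i
  proof -
    have "m (A i - K i) \<le> m (U i - K i)"
      using KU(3)[of i] by (intro content_mono) auto
    then show ?thesis using KU(4)[of i] by linarith
  qed
  define L where "L n = C \<inter> (\<Inter>i\<le>n. K i)" for n
  have "\<exists>n. L n = {}"
  proof (rule ccontr)
    assume "\<not> ?thesis"
    then have L: "L n \<noteq> {}" for n by blast
    have "C \<inter> (\<Inter>i\<in>UNIV. K i) \<noteq> {}"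
    proof (rule compact_imp_fip_image[OF compact_C KU(1)])
      fix I :: "nat set" assume I: "finite I"
      have "L (Max I) \<subseteq> C \<inter> (\<Inter>i\<in>I. K i)"
        using Max_ge[OF I] by (auto simp: L_def)
      then show "C \<inter> (\<Inter>i\<in>I. K i) \<noteq> {}" using L by blast
    qed
    then show False using A(3) KU(2) by blast
  qed
  then obtain n where n: "L n = {}" by blast
  have "norm (m (A j) - 0) < e" if j: "j \<ge> n" for j
  proof -
    have "A j \<subseteq> - C \<union> (\<Union>i\<in>{..n}. A i - K i)"
    proof
      fix x assume x: "x \<in> A j"
      then have "x \<in> A i" if "i \<le> n" for i
        using decseqD[OF A(2), of i j] j that by auto
      then show "x \<in> - C \<union> (\<Union>i\<in>{..n}. A i - K i)"
        using n by (auto simp: L_def)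
    qed
    then have "m (A j) \<le> m (- C \<union> (\<Union>i\<in>{..n}. A i - K i))"
      by (intro content_mono) auto
    also have "\<dots> \<le> m (- C) + m (\<Union>i\<in>{..n}. A i - K i)"
      by (intro content_Un_le) auto
    also have "m (\<Union>i\<in>{..n}. A i - K i) \<le> (\<Sum>i\<in>{..n}. m (A i - K i))"
      by (intro content_UN_le) auto
    also have "\<dots> \<le> (\<Sum>i\<in>{..n}. ?e i)" by (intro sum_mono small)
    also have "\<dots> < e"
    proof -
      have "(\<Sum>i\<le>n. (1 / 2 :: real) ^ Suc i) = 1 - (1 / 2) ^ Suc n"
        by (induction n) (auto simp: field_simps)
      then show ?thesis using e by (simp add: sum_distrib_left[symmetric] del: power_Suc)
    qed
    finally show ?thesis using content_Compl_C nonneg[of "A j"] by simp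
  qed
  then show "\<exists>n. \<forall>j\<ge>n. norm (m (A j) - 0) < e" by blast
qed

lemma radon_extension:
  obtains \<mu> where "prob_space \<mu>" "radon_measure \<mu>" "\<And>A. A \<in> jordan_sets \<Longrightarrow> measure \<mu> A = m A"
proof -
  interpret J: algebra UNIV jordan_sets by (rule algebra_jordan_sets)
  have "\<exists>\<nu> :: 'a set \<Rightarrow> ennreal. (\<forall>A\<in>jordan_sets. \<nu> A = ennreal (m A)) \<and>
      measure_space UNIV (sigma_sets UNIV jordan_sets) \<nu>"
  proof (rule J.caratheodory_empty_continuous)
    show "positive jordan_sets (\<lambda>A. ennreal (m A))" by (simp add: positive_def)
    show "additive jordan_sets (\<lambda>A. ennreal (m A))"
      using additive nonneg by (auto simp: Measure_Space.additive_def simp flip: ennreal_plus)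
    show "(\<lambda>i. ennreal (m (A i))) \<longlonglongrightarrow> 0"
      if "range A \<subseteq> jordan_sets" "decseq A" "(\<Inter>i. A i) = {}" for A
      using tendsto_ennrealI[OF content_tendsto_0[OF that]] by simp
  qed auto
  then obtain \<nu> :: "'a set \<Rightarrow> ennreal" where \<nu>: "\<And>A. A \<in> jordan_sets \<Longrightarrow> \<nu> A = ennreal (m A)"
    and ms: "measure_space UNIV (sigma_sets UNIV jordan_sets) \<nu>" by blast
  define \<mu> where "\<mu> = measure_of UNIV jordan_sets \<nu>"
  have sets: "sets \<mu> = sets borel"
    by (simp add: \<mu>_def sigma_sets_jordan)
  have sp: "space \<mu> = UNIV" by (simp add: \<mu>_def)
  have em: "emeasure \<mu> A = ennreal (m A)" if "A \<in> jordan_sets" for A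
    using that ms \<nu> unfolding \<mu>_def measure_space_def
    by (subst emeasure_measure_of[OF refl]) auto
  have prob: "prob_space \<mu>"
    by (rule prob_spaceI) (simp add: sp em total J.top)
  interpret prob_space \<mu> by (rule prob)
  have meas: "measure \<mu> A = m A" if "A \<in> jordan_sets" for A
    using em[OF that] nonneg[of A] by (simp add: measure_def)
  \<comment> \<open>The complement of \<open>C\<close> is a countable union of Jordan sets of
    content 0, hence null for the extension; so the extension is carried by
    \<open>C\<close>.\<close>
  obtain A :: "nat \<Rightarrow> 'a set" where A: "\<And>n. A n \<in> jordan_sets" "- C = (\<Union>n. A n)"
    using open_eq_UN_jordan[of "- C"] compact_C by (metis compact_imp_closed open_Compl)
  have "A n \<in> null_sets \<mu>" for n
  proof -
    have "m (A n) \<le> m (- C)" using A(2) by (intro content_mono) auto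
    then have "m (A n) = 0" using content_Compl_C nonneg[of "A n"] by simp
    then show ?thesis
      using em[OF A(1)[of n]] A(1)[of n] sets by (auto simp: null_sets_def jordan_sets_def)
  qed
  then have "- C \<in> null_sets \<mu>" unfolding A(2) by (intro null_sets_UN)
  then have "measure \<mu> (- C) = 0" by (simp add: measure_eq_0_null_sets)
  moreover have "C \<in> events" using compact_C sets by (auto intro: borel_compact)
  ultimately have "measure \<mu> C = 1"
    using prob_compl[of C] by (simp add: sp Compl_eq_Diff_UNIV)
  then have "radon_measure \<mu>"
    by (intro radon_measure_compact_support[OF prob sets compact_C])
  then show ?thesis using that prob meas by blast
qed

text \<open>Continuity pulls back the approximating sets, and invariance, here available for all
  sets, preserves the content of their difference.\<close>

lemma jordan_vimage:
  assumes \<psi>: "continuous_on UNIV \<psi>" "\<And>A. m (\<psi> -` A) = m A" and A: "A \<in> jordan_sets"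
  shows "\<psi> -` A \<in> jordan_sets"
proof (rule jordan_sets_I)
  have "\<psi> \<in> borel_measurable borel" using \<psi>(1) by (rule borel_measurable_continuous_onI)
  then show "\<psi> -` A \<in> sets borel"
    using A measurable_sets[of \<psi> borel borel A] by (simp add: jordan_sets_def)
  fix e :: real assume "e > 0"
  with A obtain K U where KU: "closed K" "open U" "K \<subseteq> A" "A \<subseteq> U" "m (U - K) < e"
    by (rule jordan_sets_E)
  then have "closed (\<psi> -` K)" "open (\<psi> -` U)"
    using \<psi>(1) by (auto intro: closed_vimage open_vimage)
  moreover have "m (\<psi> -` U - \<psi> -` K) < e"
    using KU(5) \<psi>(2)[of "U - K"] by (simp add: vimage_Diff)
  ultimately show "\<exists>K U. closed K \<and> open U \<and> K \<subseteq> \<psi> -` A \<and> \<psi> -` A \<subseteq> U \<and> m (U - K) < e"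
    using KU by (intro exI[of _ "\<psi> -` K"] exI[of _ "\<psi> -` U"]) auto
qed auto

text \<open>The extension and its image under \<psi> agree on the intersection-stable generator
  \<open>jordan_sets\<close>, because preimages of Jordan sets are again Jordan.\<close>

lemma invariant_extension:
  assumes \<mu>: "prob_space \<mu>" "sets \<mu> = sets borel" "\<And>A. A \<in> jordan_sets \<Longrightarrow> measure \<mu> A = m A"
    and \<psi>: "continuous_on UNIV \<psi>" "\<And>A. m (\<psi> -` A) = m A"
  shows "invariant_measure \<mu> \<psi>"
proof -
  interpret prob_space \<mu> by fact
  interpret J: algebra UNIV jordan_sets by (rule algebra_jordan_sets)
  have sp: "space \<mu> = UNIV" using sets_eq_imp_space_eq[OF \<mu>(2)] by simp
  have meas: "\<psi> \<in> measurable \<mu> borel"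
    using borel_measurable_continuous_onI[OF \<psi>(1)] by (simp add: measurable_cong_sets[OF \<mu>(2) refl])
  note J = jordan_vimage[OF \<psi>]
  have "\<mu> = distr \<mu> borel \<psi>"
  proof (rule measure_eqI_generator_eq[where E = jordan_sets and \<Omega> = UNIV and A = "\<lambda>_. UNIV"])
    show "Int_stable jordan_sets" by (auto simp: Int_stable_def)
    show "sets \<mu> = sigma_sets UNIV jordan_sets" "sets (distr \<mu> borel \<psi>) = sigma_sets UNIV jordan_sets"
      by (auto simp: \<mu>(2) sigma_sets_jordan)
    show "emeasure \<mu> A = emeasure (distr \<mu> borel \<psi>) A" if "A \<in> jordan_sets" for A
    proof -
      have "A \<in> sets borel" using that by (simp add: jordan_sets_def)
      then show ?thesis
        using \<mu>(3)[OF that] \<mu>(3)[OF J[OF that]] \<psi>(2)[of A]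
        by (simp add: emeasure_distr[OF meas] emeasure_eq_measure sp)
    qed
  qed (auto simp: emeasure_eq_measure)
  then have "emeasure \<mu> A = emeasure \<mu> (\<psi> -` A \<inter> space \<mu>)" if "A \<in> sets borel" for A
    using emeasure_distr[OF meas that] by metis
  then show ?thesis by (simp add: invariant_measure_def \<mu>(2))
qed

end

subsection \<open>Measures of large entropy\<close>

text \<open>By Tychonoff every sequence of \<open>[0, 1]\<close>-valued set functions has a cluster point for
  setwise convergence; the filter \<open>G\<close> plays the role of a convergent subnet.\<close>

lemma set_function_cluster:
  fixes s :: "nat \<Rightarrow> 'a set \<Rightarrow> real"
  assumes "\<And>n A. s n A \<in> {0..1}"
  obtains G and m :: "'a set \<Rightarrow> real"
  where "G \<noteq> bot" "G \<le> sequentially" "\<And>A. ((\<lambda>n. s n A) \<longlongrightarrow> m A) G"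
proof -
  let ?K = "PiE UNIV (\<lambda>_. {0..1}) :: ('a set \<Rightarrow> real) set"
  have "compactin (product_topology (\<lambda>_. euclidean) UNIV) ?K"
    unfolding compactin_PiE by simp
  then have "compact ?K"
    by (simp add: euclidean_product_topology)
  moreover have "filtermap s sequentially \<noteq> bot" by (simp add: filtermap_bot_iff)
  moreover have "eventually (\<lambda>x. x \<in> ?K) (filtermap s sequentially)"
    using assms by (intro always_eventually[THEN eventually_filtermap[THEN iffD2]]) auto
  ultimately obtain m where m: "inf (nhds m) (filtermap s sequentially) \<noteq> bot"
    unfolding compact_filter by blast
  \<comment> \<open>Along the pull-back of the neighbourhood filter, \<open>s\<close> tends to
    \<open>m\<close> by construction. The infimum with \<open>sequentially\<close> is proper because
    \<open>m\<close> is a cluster point, and it inherits ordinary limits.\<close>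
  define G where "G = inf (filtercomap s (nhds m)) sequentially"
  have "G \<noteq> bot"
  proof
    assume "G = bot"
    then have "eventually (\<lambda>_. False) G" by simp
    then obtain Q R where QR: "eventually Q (filtercomap s (nhds m))" "eventually R sequentially"
        "\<And>n. \<not> (Q n \<and> R n)"
      unfolding G_def eventually_inf by blast
    from QR(1) obtain Q' where Q': "eventually Q' (nhds m)" "\<And>n. Q' (s n) \<Longrightarrow> Q n"
      unfolding eventually_filtercomap by blast
    have "eventually (\<lambda>y. \<not> Q' y) (filtermap s sequentially)"
      unfolding eventually_filtermap using QR(2) by eventually_elim (use QR(3) Q'(2) in blast)
    with Q'(1) have "eventually (\<lambda>_. False) (inf (nhds m) (filtermap s sequentially))"
      unfolding eventually_inf by blast
    with m show False by simp
  qed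
  moreover have "G \<le> sequentially" by (simp add: G_def)
  moreover have "((\<lambda>n. s n A) \<longlongrightarrow> m A) G" for A
  proof -
    have "filterlim s (nhds m) (filtercomap s (nhds m))"
      by (rule filterlim_filtercomap)
    then have "(s \<longlongrightarrow> m) G"
      by (rule filterlim_mono) (auto simp: G_def)
    then show ?thesis
      by (rule continuous_on_tendsto_compose[OF continuous_on_product_coordinates]) auto
  qed
  ultimately show ?thesis by (rule that)
qed

text \<open>Labelling a point by the set of all balls containing it avoids having to disjointify them.\<close>

definition ball_label :: "'a::metric_space set \<Rightarrow> ('a \<Rightarrow> real) \<Rightarrow> 'a \<Rightarrow> 'a set" where
  "ball_label X \<rho> y = {x \<in> X. y \<in> ball x (\<rho> x)}"

lemma finite_range_ball_label: "finite X \<Longrightarrow> finite (range (ball_label X \<rho>))"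
  by (rule finite_subset[of _ "Pow X"]) (auto simp: ball_label_def)

lemma ball_label_vimage:
  assumes "algebra UNIV M" "finite X" "\<And>x. x \<in> X \<Longrightarrow> ball x (\<rho> x) \<in> M"
  shows "ball_label X \<rho> -` {S} \<in> M"
proof -
  interpret algebra UNIV M by fact
  show ?thesis
  proof (cases "S \<subseteq> X")
    case True
    have "ball_label X \<rho> -` {S} = UNIV - ((\<Union>x\<in>X - S. ball x (\<rho> x)) \<union> (\<Union>x\<in>S. UNIV - ball x (\<rho> x)))"
      using True by (auto simp: ball_label_def)
    also have "\<dots> \<in> M"
      using assms True finite_subset[OF True assms(2)]
      by (intro Diff Un finite_UN top) auto
    finally show ?thesis .
  next
    case False
    then have "ball_label X \<rho> -` {S} = {}" by (auto simp: ball_label_def)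
    then show ?thesis by simp
  qed
qed

text \<open>Some ball of the family contains \<open>y\<close>; equality of labels puts
  \<open>z\<close> into the same ball.\<close>

lemma ball_label_dist:
  assumes "C \<subseteq> (\<Union>x\<in>X. ball x (\<rho> x))" "\<And>x. x \<in> X \<Longrightarrow> \<rho> x \<le> \<epsilon> / 2"
    and "y \<in> C" "ball_label X \<rho> y = ball_label X \<rho> z"
  shows "dist y z < \<epsilon>"
proof -
  obtain x where x: "x \<in> X" "y \<in> ball x (\<rho> x)" using assms by blast
  then have "x \<in> ball_label X \<rho> z" unfolding assms(4)[symmetric] by (simp add: ball_label_def)
  then have "dist x z < \<rho> x" by (simp add: ball_label_def)
  moreover have "dist x y < \<rho> x" using x by simp
  ultimately show ?thesis
    using assms(2)[OF x(1)] dist_triangle[of y z x] by (simp add: dist_commute)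
qed

section \<open>Separated sets and their counting measures\<close>

definition separated :: "'a::metric_space set \<Rightarrow> ('a \<Rightarrow> 'a) \<Rightarrow> real \<Rightarrow> nat \<Rightarrow> 'a set \<Rightarrow> bool" where
  "separated C f \<epsilon> n E \<longleftrightarrow>
     E \<subseteq> C \<and> (\<forall>x\<in>E. \<forall>y\<in>E. (\<forall>i<n. dist ((f ^^ i) x) ((f ^^ i) y) < \<epsilon>) \<longrightarrow> x = y)"

lemma separated_inj_on_itinerary:
  assumes E: "separated C f \<epsilon> n E" and f: "f ` C \<subseteq> C"
    and p: "\<And>y z. y \<in> C \<Longrightarrow> z \<in> C \<Longrightarrow> p y = p z \<Longrightarrow> dist y z < \<epsilon>"
  shows "inj_on (itinerary f p n) E"
proof (rule inj_onI)
  fix x y assume xy: "x \<in> E" "y \<in> E" "itinerary f p n x = itinerary f p n y"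
  then have "x \<in> C" "y \<in> C" using E by (auto simp: separated_def)
  then have "dist ((f ^^ i) x) ((f ^^ i) y) < \<epsilon>" if "i < n" for i
    using xy(3) that by (intro p funpow_image_subset[OF f]) (auto simp: itinerary_eq_iff)
  then show "x = y" using E xy by (auto simp: separated_def)
qed

text \<open>Points of a separated set have different itineraries, which bounds its cardinality. In a
  largest one no further point fits, so every orbit segment is followed by one of its
  points.\<close>

lemma ex_maximal_separated:
  assumes f: "f ` C \<subseteq> C" and \<epsilon>: "\<epsilon> > 0" and p: "finite (range p)"
    "\<And>y z. y \<in> C \<Longrightarrow> z \<in> C \<Longrightarrow> p y = p z \<Longrightarrow> dist y z < \<epsilon>"
  obtains E where "finite E" "separated C f \<epsilon> n E"
    "\<And>y. y \<in> C \<Longrightarrow> \<exists>x\<in>E. \<forall>i<n. dist ((f ^^ i) x) ((f ^^ i) y) < \<epsilon>"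
proof -
  let ?W = "{xs. set xs \<subseteq> range p \<and> length xs = n}"
  have W: "finite ?W" using p(1) by (rule finite_lists_length_eq)
  have fin: "finite E" and card: "card E < Suc (card ?W)" if "separated C f \<epsilon> n E" for E
  proof -
    have inj: "inj_on (itinerary f p n) E" by (rule separated_inj_on_itinerary[OF that f p(2)])
    have sub: "itinerary f p n ` E \<subseteq> ?W" using range_itinerary[of f p n] by blast
    show "finite E" using inj_on_finite[OF inj sub W] .
    show "card E < Suc (card ?W)" using card_inj_on_le[OF inj sub W] by simp
  qed
  have "separated C f \<epsilon> n {}" by (simp add: separated_def)
  then have "\<exists>E. separated C f \<epsilon> n E \<and> (\<forall>E'. separated C f \<epsilon> n E' \<longrightarrow> card E' \<le> card E)"
    using card by (intro ex_has_greatest_nat[where b = "Suc (card ?W)"]) auto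
  then obtain E where E: "separated C f \<epsilon> n E" "\<And>E'. separated C f \<epsilon> n E' \<Longrightarrow> card E' \<le> card E"
    by blast
  have "\<exists>x\<in>E. \<forall>i<n. dist ((f ^^ i) x) ((f ^^ i) y) < \<epsilon>" if y: "y \<in> C" for y
  proof (rule ccontr)
    assume far: "\<not> ?thesis"
    then have "y \<notin> E" using \<epsilon> by auto
    moreover have "separated C f \<epsilon> n (insert y E)"
      using far E(1) y unfolding separated_def by (auto simp: dist_commute)
    ultimately show False using E(2)[of "insert y E"] fin[OF E(1)] by simp
  qed
  then show ?thesis using that[OF fin[OF E(1)] E(1)] by blast
qed

definition uniform_content :: "'a set \<Rightarrow> 'a set \<Rightarrow> real" where
  "uniform_content E A = card (E \<inter> A) / card E"

lemma prob_content_uniform: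
  assumes "finite E" "E \<noteq> {}"
  shows "prob_content UNIV (uniform_content E)"
proof (intro prob_content.intro prob_content_axioms.intro)
  show "algebra UNIV (UNIV :: 'a set set)" by (simp add: algebra_iff_Un)
  show "uniform_content E UNIV = 1" using assms by (simp add: uniform_content_def)
  fix A B :: "'a set" assume "A \<inter> B = {}"
  then have "card (E \<inter> (A \<union> B)) = card (E \<inter> A) + card (E \<inter> B)"
    unfolding Int_Un_distrib using assms by (intro card_Un_disjoint) auto
  then show "uniform_content E (A \<union> B) = uniform_content E A + uniform_content E B"
    by (simp add: uniform_content_def add_divide_distrib)
qed (simp add: uniform_content_def)

lemma fibre_entropy_uniform:
  assumes E: "finite E" "E \<noteq> {}" and X: "finite (range X)" "inj_on X E"
  shows "fibre_entropy (uniform_content E) X = ln (card E)"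
proof -
  have c: "card E > 0" using E by (simp add: card_gt_0_iff)
  have 1: "uniform_content E (X -` {X x}) = 1 / card E" if "x \<in> E" for x
  proof -
    have "E \<inter> X -` {X x} = {x}" using X(2) that by (auto simp: inj_on_def)
    then show ?thesis by (simp add: uniform_content_def)
  qed
  have 0: "uniform_content E (X -` {v}) = 0" if "v \<notin> X ` E" for v
  proof -
    have "E \<inter> X -` {v} = {}" using that by auto
    then show ?thesis by (simp add: uniform_content_def)
  qed
  have "fibre_entropy (uniform_content E) X = (\<Sum>v\<in>X ` E. eta (uniform_content E (X -` {v})))"
    unfolding fibre_entropy_def using X(1) 0 by (intro sum.mono_neutral_right) auto
  also have "\<dots> = (\<Sum>x\<in>E. eta (1 / card E))"
    using X(2) by (simp add: sum.reindex 1)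
  also have "\<dots> = ln (card E)" using c by (simp add: eta_def)
  finally show ?thesis .
qed

section \<open>Averages along orbits and spanning sets\<close>

definition orbit_average :: "('a \<Rightarrow> 'a) \<Rightarrow> ('a set \<Rightarrow> real) \<Rightarrow> nat \<Rightarrow> 'a set \<Rightarrow> real" where
  "orbit_average f m n A = 1 / n * (\<Sum>i<n. m ((f ^^ i) -` A))"

text \<open>Concavity of entropy in the content: Jensen's inequality on each fibre.\<close>

lemma fibre_entropy_orbit_average:
  assumes m: "prob_content UNIV m" and n: "n > 0" and X: "finite (range X)"
  shows "(\<Sum>i<n. fibre_entropy m (\<lambda>x. X ((f ^^ i) x))) \<le> n * fibre_entropy (orbit_average f m n) X"
proof -
  interpret prob_content UNIV m by fact
  have "(\<Sum>i<n. fibre_entropy m (\<lambda>x. X ((f ^^ i) x)))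
    = (\<Sum>i<n. \<Sum>v\<in>range X. eta (m ((f ^^ i) -` (X -` {v}))))"
  proof (rule sum.cong[OF refl])
    fix i
    have "fibre_entropy m (\<lambda>x. X ((f ^^ i) x)) = (\<Sum>v\<in>range X. eta (m ((\<lambda>x. X ((f ^^ i) x)) -` {v})))"
      using X by (intro fibre_entropy_superset) auto
    then show "fibre_entropy m (\<lambda>x. X ((f ^^ i) x)) = (\<Sum>v\<in>range X. eta (m ((f ^^ i) -` (X -` {v}))))"
      by (simp add: vimage_def)
  qed
  also have "\<dots> = (\<Sum>v\<in>range X. \<Sum>i<n. eta (m ((f ^^ i) -` (X -` {v}))))"
    by (rule sum.swap)
  also have "\<dots> \<le> (\<Sum>v\<in>range X. n * eta (orbit_average f m n (X -` {v})))"
    unfolding orbit_average_def by (intro sum_mono eta_concave n nonneg) auto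
  finally show ?thesis by (simp add: fibre_entropy_def sum_distrib_left)
qed

lemma orbit_average_bounds:
  assumes "prob_content UNIV m"
  shows "orbit_average f m n A \<in> {0..1}"
proof -
  interpret prob_content UNIV m by fact
  have "(\<Sum>i<n. m ((f ^^ i) -` A)) \<le> n"
    using sum_mono[of "{..<n}" "\<lambda>i. m ((f ^^ i) -` A)" "\<lambda>_. 1"] content_le_1 by simp
  then show ?thesis
    by (cases "n = 0") (auto simp: orbit_average_def nonneg sum_nonneg)
qed

text \<open>The sums telescope, leaving a first and a last term, both in [0, 1].\<close>

lemma orbit_average_invariant:
  assumes "prob_content UNIV m"
  shows "\<bar>orbit_average f m n (f -` A) - orbit_average f m n A\<bar> \<le> 1 / n"
proof -
  interpret prob_content UNIV m by fact
  let ?a = "\<lambda>i. m ((f ^^ i) -` A)"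
  have "(f ^^ i) -` (f -` A) = (f ^^ Suc i) -` A" for i by auto
  then have "(\<Sum>i<n. m ((f ^^ i) -` (f -` A))) = (\<Sum>i<n. ?a (Suc i))" by simp
  moreover have "(\<Sum>i<n. ?a (Suc i)) - (\<Sum>i<n. ?a i) = ?a n - ?a 0"
    unfolding sum_subtractf[symmetric] by (rule sum_lessThan_telescope)
  ultimately have "(\<Sum>i<n. m ((f ^^ i) -` (f -` A))) - (\<Sum>i<n. ?a i) = ?a n - ?a 0"
    by (simp only:)
  then have "orbit_average f m n (f -` A) - orbit_average f m n A = (?a n - ?a 0) / n"
    by (simp add: orbit_average_def diff_divide_distrib[symmetric])
  moreover have "\<bar>?a n - ?a 0\<bar> \<le> 1"
    using nonneg[of "(f ^^ n) -` A"] nonneg[of A] content_le_1[of "(f ^^ n) -` A"] content_le_1[of A]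
    by simp
  ultimately show ?thesis by (simp add: abs_divide divide_right_mono)
qed

text \<open>Here \<epsilon> acts as a Lebesgue number. Choosing a member of the cover around each
  orbit point of \<open>x\<close> gives a member of the join that contains every point following
  \<open>x\<close> within \<epsilon> for \<open>n\<close> steps.\<close>

lemma cover_number_le_card_spanning:
  assumes E: "finite E" "E \<subseteq> C"
    and span: "\<And>y. y \<in> C \<Longrightarrow> \<exists>x\<in>E. \<forall>i<n. dist ((f ^^ i) x) ((f ^^ i) y) < \<epsilon>"
    and f: "f ` C \<subseteq> C"
    and \<epsilon>: "\<And>x. x \<in> C \<Longrightarrow> \<exists>A\<in>\<A>. ball x \<epsilon> \<inter> C \<subseteq> A"
  shows "cover_number C (iterated_join C f \<A> n) \<le> card E"
proof -
  obtain A where A: "\<And>x. x \<in> C \<Longrightarrow> A x \<in> \<A>" "\<And>x. x \<in> C \<Longrightarrow> ball x \<epsilon> \<inter> C \<subseteq> A x"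
    using \<epsilon> by metis
  define D where "D x = C \<inter> (\<Inter>i<n. (f ^^ i) -` A ((f ^^ i) x))" for x
  have "cover_number C (iterated_join C f \<A> n) \<le> card (D ` E)"
  proof (rule cover_number_le)
    show "D ` E \<subseteq> iterated_join C f \<A> n"
    proof clarify
      fix x assume "x \<in> E"
      then have "x \<in> C" using E by blast
      then show "D x \<in> iterated_join C f \<A> n"
        unfolding D_def by (intro iterated_join_I A(1) funpow_image_subset[OF f])
    qed
    show "\<Union>(D ` E) = C"
    proof
      show "C \<subseteq> \<Union>(D ` E)"
      proof
        fix y assume y: "y \<in> C"
        then obtain x where x: "x \<in> E" "\<forall>i<n. dist ((f ^^ i) x) ((f ^^ i) y) < \<epsilon>"
          using span by blast
        have "(f ^^ i) y \<in> A ((f ^^ i) x)" if "i < n" for i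
        proof -
          have "(f ^^ i) x \<in> C" "(f ^^ i) y \<in> C"
            using x(1) y E(2) by (auto intro!: funpow_image_subset[OF f])
          then show ?thesis using A(2)[of "(f ^^ i) x"] x(2) that by auto
        qed
        then have "y \<in> D x" using y by (auto simp: D_def)
        then show "y \<in> \<Union>(D ` E)" using x by blast
      qed
    qed (auto simp: D_def)
  qed (use E in simp)
  also have "\<dots> \<le> card E" using E(1) by (rule card_image_le)
  finally show ?thesis .
qed

text \<open>"Eventually" is needed because the orbit average of length 0 is identically 0.\<close>

lemma prob_content_limit:
  fixes m :: "'a set \<Rightarrow> real"
  assumes G: "G \<noteq> bot" and s: "\<forall>\<^sub>F n in G. prob_content UNIV (s n)"
    and lim: "\<And>A. ((\<lambda>n. s n A) \<longlongrightarrow> m A) G"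
  shows "prob_content UNIV m"
proof (intro prob_content.intro prob_content_axioms.intro)
  show "algebra UNIV (UNIV :: 'a set set)" by (simp add: algebra_iff_Un)
  show "0 \<le> m A" for A
    by (rule tendsto_lowerbound[OF lim _ G])
       (use s in \<open>eventually_elim, auto simp: prob_content.nonneg\<close>)
  have "\<forall>\<^sub>F n in G. s n UNIV = 1"
    using s by eventually_elim (rule prob_content.total)
  then show "m UNIV = 1"
    using tendsto_unique[OF G lim[of UNIV] tendsto_eventually] by blast
  show "m (A \<union> B) = m A + m B" if "A \<inter> B = {}" for A B
  proof (rule tendsto_unique[OF G lim])
    have "\<forall>\<^sub>F n in G. s n A + s n B = s n (A \<union> B)"
      using s by eventually_elim (use that in \<open>simp add: prob_content.additive\<close>)
    then show "((\<lambda>n. s n (A \<union> B)) \<longlongrightarrow> m A + m B) G"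
      by (rule Lim_transform_eventually[OF tendsto_add[OF lim lim]])
  qed
qed

lemma prob_content_orbit_average:
  assumes "prob_content UNIV m" "n > 0"
  shows "prob_content UNIV (orbit_average f m n)"
proof (intro prob_content.intro prob_content_axioms.intro)
  interpret prob_content UNIV m by fact
  show "algebra UNIV (UNIV :: 'a set set)" by (rule algebra_axioms)
  show "0 \<le> orbit_average f m n A" for A
    using orbit_average_bounds[OF assms(1), of f n A] by simp
  show "orbit_average f m n UNIV = 1"
    using assms(2) by (simp add: orbit_average_def total)
  show "orbit_average f m n (A \<union> B) = orbit_average f m n A + orbit_average f m n B"
    if "A \<inter> B = {}" for A B
  proof -
    have "m ((f ^^ i) -` (A \<union> B)) = m ((f ^^ i) -` A) + m ((f ^^ i) -` B)" for i
      unfolding vimage_Un using that by (intro additive) auto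
    then show ?thesis by (simp add: orbit_average_def sum.distrib add_divide_distrib)
  qed
qed

lemma topological_entropy_cover_le_KS_entropy:
  fixes \<psi> :: "'a::metric_space \<Rightarrow> 'a"
  assumes cont: "continuous_on UNIV \<psi>" and C: "compact C" "\<psi> ` C \<subseteq> C" "C \<noteq> {}"
    and \<A>: "admissible_cover (top_of_set C) \<A>"
  obtains \<mu> where "prob_space \<mu>" "radon_measure \<mu>" "invariant_measure \<mu> \<psi>"
    "ennreal (topological_entropy_cover (top_of_set C) (restrict \<psi> C) \<A>) \<le> KS_entropy \<mu> \<psi>"
proof -
  have \<A>': "\<And>A. A \<in> \<A> \<Longrightarrow> openin (top_of_set C) A" "\<Union>\<A> = C"
    using \<A> unfolding admissible_cover_compact[OF C(1)] by auto
  \<comment> \<open>Members of the cover are open only relative to \<open>C\<close>. The Lebesgue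
    number is taken for open sets of the whole space with trace in the cover.\<close>
  have "C \<subseteq> \<Union>{V. open V \<and> C \<inter> V \<in> \<A>}"
  proof
    fix x assume "x \<in> C"
    then obtain A where A: "A \<in> \<A>" "x \<in> A" using \<A>'(2) by blast
    then obtain V where "open V" "A = C \<inter> V" using \<A>'(1) by (auto simp: openin_open)
    then show "x \<in> \<Union>{V. open V \<and> C \<inter> V \<in> \<A>}" using A by blast
  qed
  then obtain \<epsilon> where \<epsilon>: "\<epsilon> > 0"
      and leb: "\<And>x. x \<in> C \<Longrightarrow> \<exists>V\<in>{V. open V \<and> C \<inter> V \<in> \<A>}. ball x \<epsilon> \<subseteq> V"
    by (rule Heine_Borel_lemma[OF C(1)]) auto
  have leb: "\<exists>A\<in>\<A>. ball x \<epsilon> \<inter> C \<subseteq> A" if "x \<in> C" for x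
    using leb[OF that] by blast

  \<comment> \<open>Radius \<epsilon> / 4 leaves room to enlarge the balls below \<epsilon> / 2: the
    centres are used again once the limit content, and with it the admissible radii, are
    known.\<close>
  have "C \<subseteq> (\<Union>x\<in>C. ball x (\<epsilon> / 4))" using \<epsilon> by auto
  then obtain X where X: "finite X" "C \<subseteq> (\<Union>x\<in>X. ball x (\<epsilon> / 4))"
    by (rule compactE_image[OF C(1) open_ball]) blast
  have "\<exists>E. finite E \<and> separated C \<psi> \<epsilon> n E \<and>
      (\<forall>y\<in>C. \<exists>x\<in>E. \<forall>i<n. dist ((\<psi> ^^ i) x) ((\<psi> ^^ i) y) < \<epsilon>)" for n
  proof -
    have "dist y z < \<epsilon>" if "y \<in> C" "ball_label X (\<lambda>_. \<epsilon> / 4) y = ball_label X (\<lambda>_. \<epsilon> / 4) z" for y z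
      by (rule ball_label_dist[OF X(2) _ that]) (use \<epsilon> in simp)
    then show ?thesis
      using ex_maximal_separated[OF C(2) \<epsilon> finite_range_ball_label[OF X(1)], of "\<lambda>_. \<epsilon> / 4" n] by metis
  qed
  then obtain E where E: "\<And>n. finite (E n)" "\<And>n. separated C \<psi> \<epsilon> n (E n)"
      and span: "\<And>n y. y \<in> C \<Longrightarrow> \<exists>x\<in>E n. \<forall>i<n. dist ((\<psi> ^^ i) x) ((\<psi> ^^ i) y) < \<epsilon>"
    by metis
  have E_ne: "E n \<noteq> {}" and E_C: "E n \<subseteq> C" for n
    using span[of _ n] C(3) E(2)[of n] by (auto simp: separated_def)
  define N where "N n = cover_number C (iterated_join C \<psi> \<A> n)" for n
  have N_le: "N n \<le> card (E n)" for n
    unfolding N_def by (rule cover_number_le_card_spanning[OF E(1) E_C span C(2) leb])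
  define T where "T = topological_entropy_cover (top_of_set C) (restrict \<psi> C) \<A>"
  have T: "(\<lambda>n. 1 / n * ln (N n)) \<longlonglongrightarrow> T"
    unfolding N_def T_def by (rule topological_entropy_cover_tendsto[OF C(1,2) \<A>])

  define \<sigma> where "\<sigma> n = uniform_content (E n)" for n
  have \<sigma>: "prob_content UNIV (\<sigma> n)" for n
    unfolding \<sigma>_def by (rule prob_content_uniform[OF E(1) E_ne])
  define s where "s n = orbit_average \<psi> (\<sigma> n) n" for n
  have s01: "s n A \<in> {0..1}" for n A
    unfolding s_def by (rule orbit_average_bounds[OF \<sigma>])
  obtain G m where G: "G \<noteq> bot" "G \<le> sequentially" and lim: "\<And>A. ((\<lambda>n. s n A) \<longlongrightarrow> m A) G"
    using set_function_cluster[of s, OF s01] by blast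
  have ev: "\<forall>\<^sub>F n in G. P n" if "\<And>n. n \<ge> k \<Longrightarrow> P n" for P and k :: nat
    using filter_leD[OF G(2) eventually_sequentiallyI[of k P]] that by blast
  have "\<forall>\<^sub>F n in G. prob_content UNIV (s n)"
    by (rule ev[of 1]) (simp add: s_def prob_content_orbit_average \<sigma>)
  then have "prob_content UNIV m"
    by (rule prob_content_limit[OF G(1) _ lim])
  then interpret prob_content UNIV m .
  have m01: "0 \<le> m A" for A by (rule nonneg) simp
  have inv: "m (\<psi> -` A) = m A" for A
  proof -
    have "((\<lambda>n. s n (\<psi> -` A) - s n A) \<longlongrightarrow> 0) G"
    proof (rule Lim_null_comparison)
      show "\<forall>\<^sub>F n in G. norm (s n (\<psi> -` A) - s n A) \<le> 1 / n"
        using orbit_average_invariant[OF \<sigma>] by (intro always_eventually) (simp add: s_def)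
      show "((\<lambda>n. 1 / n) \<longlongrightarrow> 0) G"
        by (rule tendsto_mono[OF G(2) lim_1_over_n])
    qed
    then have "m (\<psi> -` A) - m A = 0"
      by (rule tendsto_unique[OF G(1) tendsto_diff[OF lim lim]])
    then show ?thesis by simp
  qed
  have "m C = 1"
  proof (rule tendsto_unique[OF G(1) lim])
    have "s n C = 1" if "n \<ge> 1" for n
    proof -
      have "E n \<inter> (\<psi> ^^ i) -` C = E n" for i
        using funpow_image_subset[OF C(2) subsetD[OF E_C]] by auto
      then show ?thesis
        using that E(1) E_ne by (simp add: s_def orbit_average_def \<sigma>_def uniform_content_def)
    qed
    then show "((\<lambda>n. s n C) \<longlongrightarrow> 1) G"
      by (intro tendsto_eventually ev[of 1]) auto
  qed
  then interpret tight_content m C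
    using C(1) by unfold_locales auto
  obtain \<mu> where \<mu>: "prob_space \<mu>" "radon_measure \<mu>" and ext: "\<And>A. A \<in> jordan_sets \<Longrightarrow> measure \<mu> A = m A"
    using radon_extension by blast
  have sets_\<mu>: "sets \<mu> = sets borel" using \<mu>(2) by (simp add: radon_measure_def)
  have sp: "space \<mu> = UNIV" using sets_eq_imp_space_eq[OF sets_\<mu>] by simp
  have inv_\<mu>: "invariant_measure \<mu> \<psi>"
    by (rule invariant_extension[OF \<mu>(1) sets_\<mu> ext cont inv])

  \<comment> \<open>Balls are superlevel sets of the negative distance, so some radius gives a
    Jordan ball. Above \<epsilon> / 4 the balls still cover \<open>C\<close>; below \<epsilon> / 2
    their points have distance less than \<epsilon>.\<close>
  have "\<exists>r. \<epsilon> / 4 < r \<and> r < \<epsilon> / 2 \<and> ball x r \<in> jordan_sets" for x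
  proof -
    have "continuous_on UNIV (\<lambda>y. - dist x y)" by (intro continuous_intros)
    then obtain t where t: "- \<epsilon> / 2 < t" "t < - \<epsilon> / 4" "{y. t < - dist x y} \<in> jordan_sets"
      by (rule jordan_superlevel_between[of _ "- \<epsilon> / 2" "- \<epsilon> / 4"]) (use \<epsilon> in auto)
    moreover have "{y. t < - dist x y} = ball x (- t)" by auto
    ultimately show ?thesis by (intro exI[of _ "- t"]) auto
  qed
  then obtain \<rho> where \<rho>: "\<And>x. \<epsilon> / 4 < \<rho> x" "\<And>x. \<rho> x < \<epsilon> / 2" "\<And>x. ball x (\<rho> x) \<in> jordan_sets"
    by metis
  define p where "p = ball_label X \<rho>"
  have fin_p: "finite (range p)" unfolding p_def by (rule finite_range_ball_label[OF X(1)])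
  have p_jordan: "p -` {v} \<in> jordan_sets" for v
    unfolding p_def by (rule ball_label_vimage[OF algebra_jordan_sets X(1) \<rho>(3)])
  have p_sets: "p -` {v} \<in> sets \<mu>" for v
    using p_jordan sets_\<mu> by (auto simp: jordan_sets_def)
  have "C \<subseteq> (\<Union>x\<in>X. ball x (\<rho> x))"
  proof
    fix y assume "y \<in> C"
    then obtain x where "x \<in> X" "dist x y < \<epsilon> / 4" using X(2) by auto
    moreover from this have "dist x y < \<rho> x" using \<rho>(1)[of x] by linarith
    ultimately show "y \<in> (\<Union>x\<in>X. ball x (\<rho> x))" by auto
  qed
  from ball_label_dist[OF this less_imp_le[OF \<rho>(2)]]
  have p_fine: "dist y z < \<epsilon>" if "y \<in> C" "p y = p z" for y z
    using that by (simp add: p_def)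
  define c where "c = card (range p)"

  interpret J: content_map jordan_sets m \<psi>
  proof (intro content_map.intro content_map_axioms.intro prob_content.intro prob_content_axioms.intro)
    show "algebra UNIV jordan_sets" by (rule algebra_jordan_sets)
    show "\<psi> -` A \<in> jordan_sets" if "A \<in> jordan_sets" for A
      using that by (rule jordan_vimage[OF cont inv])
  qed (auto simp: m01 total additive)
  have J_p: "J.observable p" using fin_p p_jordan by (simp add: J.observable_def)
  \<comment> \<open>Cells of itineraries are Jordan sets, where \<mu> and \<open>m\<close> agree;
    this carries the entropy of the finitely additive limit over to \<mu>.\<close>
  have H_eq: "fibre_entropy (measure \<mu>) (itinerary \<psi> p q) = fibre_entropy m (itinerary \<psi> p q)" for q
    unfolding fibre_entropy_def
    using ext J.observable_fibre[OF J.observable_itinerary[OF J_p]] by simp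

  \<comment> \<open>For fixed \<open>q\<close> only finitely many cells occur, so setwise
    convergence along \<open>G\<close> suffices to let \<open>n\<close> grow, and the error
    \<open>q * ln c / n\<close> disappears.\<close>
  have main: "T \<le> 1 / q * fibre_entropy (measure \<mu>) (itinerary \<psi> p q)" if q: "q \<ge> 1" for q
  proof -
    let ?H = "\<lambda>n. fibre_entropy (s n) (itinerary \<psi> p q)"
    have fin_it: "finite (range (itinerary \<psi> p q))" for q
      by (rule finite_subset[OF range_itinerary finite_lists_length_eq[OF fin_p]])
    have "1 / n * ln (N n) \<le> 1 / q * ?H n + q * ln c / n" if n: "n \<ge> q" for n
    proof -
      interpret S: content_map UNIV "\<sigma> n" \<psi>
        by (intro content_map.intro content_map_axioms.intro \<sigma>) auto
      have n0: "n > 0" using n q by simp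
      have obs: "S.observable p" using fin_p by (simp add: S.observable_def)
      have "fibre_entropy (\<sigma> n) (itinerary \<psi> p n) = ln (card (E n))"
        unfolding \<sigma>_def using p_fine
        by (intro fibre_entropy_uniform E(1) E_ne fin_it separated_inj_on_itinerary[OF E(2) C(2)]) auto
      then have "q * ln (card (E n)) \<le> (\<Sum>i<n. fibre_entropy (\<sigma> n) (\<lambda>x. itinerary \<psi> p q ((\<psi> ^^ i) x))) + q * q * ln c"
        using S.entropy_itinerary_blocks[OF obs c_def n] by simp
      also have "(\<Sum>i<n. fibre_entropy (\<sigma> n) (\<lambda>x. itinerary \<psi> p q ((\<psi> ^^ i) x))) \<le> n * ?H n"
        unfolding s_def by (rule fibre_entropy_orbit_average[OF \<sigma> n0 fin_it])
      finally have *: "q * ln (card (E n)) \<le> n * ?H n + q * q * ln c" by simp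
      have "ln (N n) \<le> ln (card (E n))"
      proof (cases "N n = 0")
        case True
        have "card (E n) > 0" using E(1) E_ne by (simp add: card_gt_0_iff)
        with True show ?thesis by simp
      next
        case False
        then show ?thesis using N_le[of n] by (intro ln_mono) auto
      qed
      then have "q * ln (N n) \<le> n * ?H n + q * q * ln c"
        using * mult_left_mono[of "ln (N n)" "ln (card (E n))" q] by simp
      then show ?thesis using n0 q by (simp add: field_simps)
    qed
    then have le: "\<forall>\<^sub>F n in G. 1 / n * ln (N n) \<le> 1 / q * ?H n + q * ln c / n"
      by (rule ev)
    have "(?H \<longlongrightarrow> fibre_entropy m (itinerary \<psi> p q)) G"
      unfolding fibre_entropy_def using s01 m01
      by (intro tendsto_sum tendsto_eta lim) auto
    moreover have "((\<lambda>n. q * ln c / n) \<longlongrightarrow> 0) G"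
      by (rule tendsto_mono[OF G(2) lim_const_over_n])
    ultimately have "((\<lambda>n. 1 / q * ?H n + q * ln c / n) \<longlongrightarrow> 1 / q * fibre_entropy m (itinerary \<psi> p q) + 0) G"
      by (intro tendsto_intros)
    moreover have "((\<lambda>n. 1 / n * ln (N n)) \<longlongrightarrow> T) G"
      by (rule tendsto_mono[OF G(2) T])
    ultimately have "T \<le> 1 / q * fibre_entropy m (itinerary \<psi> p q) + 0"
      using le by (rule tendsto_le[OF G(1)])
    then show ?thesis by (simp add: H_eq)
  qed

  interpret M: invariant_content "sets \<mu>" "measure \<mu>" \<psi>
    by (rule invariant_content_measure[OF \<mu>(1) sets_\<mu> inv_\<mu> cont])
  have obs_p: "M.observable p" using fin_p p_sets by (simp add: M.observable_def)
  let ?P = "(\<lambda>v. p -` {v}) ` range p"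
  have "(\<lambda>q. 1 / q * fibre_entropy (measure \<mu>) (itinerary \<psi> p q)) \<longlonglongrightarrow> KS_entropy_partition \<mu> \<psi> ?P"
    unfolding KS_entropy_partition_def partition_entropy_fibres[OF sp fin_p]
    by (rule fekete_lim(1)[OF M.entropy_itinerary_nonneg[OF obs_p] M.entropy_itinerary_subadditive[OF obs_p]])
  then have "T \<le> KS_entropy_partition \<mu> \<psi> ?P"
    using main by (intro LIMSEQ_le_const) auto
  then have "ennreal T \<le> ennreal (KS_entropy_partition \<mu> \<psi> ?P)" by (rule ennreal_leI)
  also have "\<dots> \<le> KS_entropy \<mu> \<psi>"
    unfolding KS_entropy_def
    using partition_of_observable[OF sp fin_p p_sets] by (intro SUP_upper) simp
  finally show ?thesis
    using that[OF \<mu> inv_\<mu>] by (simp add: T_def)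
qed

text \<open>Some initial \<open>C l\<close> may be empty and then carry no probability
  measure.\<close>

lemma topological_entropy_cover_empty:
  assumes "admissible_cover (top_of_set {}) \<A>"
  shows "topological_entropy_cover (top_of_set {}) (restrict f {}) \<A> = 0"
proof -
  have "cover_number {} (iterated_join {} f \<A> n) = 0" for n
    using cover_number_le[of "{}" "iterated_join {} f \<A> n" "{}"] by simp
  then have "(\<lambda>n. 0) \<longlonglongrightarrow> topological_entropy_cover (top_of_set {}) (restrict f {}) \<A>"
    using topological_entropy_cover_tendsto[of "{}" f \<A>] assms by simp
  then show ?thesis by (simp add: LIMSEQ_const_iff)
qed

theorem theorem2p7:
  fixes \<psi> :: "'a::metric_space \<Rightarrow> 'a"
    and C :: "nat \<Rightarrow> 'a set"
  assumes "continuous_on UNIV \<psi>"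
    and "(\<Union>l. C l) = UNIV"
    and "\<And>l. compact (C l)"
    and "\<And>l. \<psi> ` C l \<subseteq> C l"
    and "\<And>l. C l \<subseteq> C (Suc l)"
  shows "(\<lambda>l. topological_entropy (top_of_set (C l)) (restrict \<psi> (C l)))
           \<longlonglongrightarrow> (SUP \<mu>\<in>{\<mu>. prob_space \<mu> \<and> radon_measure \<mu> \<and> invariant_measure \<mu> \<psi>}. KS_entropy \<mu> \<psi>)"
    (is "?h \<longlonglongrightarrow> ?S")
proof (rule order_tendstoI)
  have le: "?h l \<le> ?S" for l
    unfolding topological_entropy_def
  proof (rule SUP_least)
    fix \<A> assume "\<A> \<in> {\<A>. admissible_cover (top_of_set (C l)) \<A>}"
    then have \<A>: "admissible_cover (top_of_set (C l)) \<A>" by simp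
    show "ennreal (topological_entropy_cover (top_of_set (C l)) (restrict \<psi> (C l)) \<A>) \<le> ?S"
    proof (cases "C l = {}")
      case True
      then show ?thesis using topological_entropy_cover_empty[of \<A> \<psi>] \<A> by simp
    next
      case False
      obtain \<mu> where "prob_space \<mu>" "radon_measure \<mu>" "invariant_measure \<mu> \<psi>"
        and le: "ennreal (topological_entropy_cover (top_of_set (C l)) (restrict \<psi> (C l)) \<A>) \<le> KS_entropy \<mu> \<psi>"
        using topological_entropy_cover_le_KS_entropy[OF assms(1,3,4) False \<A>] .
      then have "KS_entropy \<mu> \<psi> \<le> ?S" by (intro SUP_upper) simp
      with le show ?thesis by (rule order_trans)
    qed
  qed
  show "\<forall>\<^sub>F l in sequentially. ?h l < a" if "?S < a" for a
    using le that by (intro always_eventually allI) (rule le_less_trans)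
  show "\<forall>\<^sub>F l in sequentially. a < ?h l" if lt: "a < ?S" for a
  proof -
    obtain \<mu> where \<mu>: "prob_space \<mu>" "radon_measure \<mu>" "invariant_measure \<mu> \<psi>" and "a < KS_entropy \<mu> \<psi>"
      using lt unfolding less_SUP_iff by blast
    then obtain \<P> where P: "finite_measurable_partition \<mu> \<P>"
      and a: "a < ennreal (KS_entropy_partition \<mu> \<psi> \<P>)"
      unfolding KS_entropy_def less_SUP_iff by blast
    define h where "h = KS_entropy_partition \<mu> \<psi> \<P>"
    obtain a' where a': "a = ennreal a'" "0 \<le> a'"
      using a by (cases a) auto
    then have "a' < h" using a by (simp add: h_def ennreal_less_iff)
    \<comment> \<open>The loss 3 / k has to fit into the gap between \<open>a\<close> and the
      entropy of the chosen partition.\<close>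
    then obtain k :: nat where k: "k > 0" "3 / real k < h - a'"
      using reals_Archimedean2[of "3 / (h - a')"]
      by (metis diff_gt_0_iff_gt divide_less_eq mult.commute not_gr_zero of_nat_0 of_nat_0_less_iff
          order_less_trans zero_less_divide_iff zero_less_numeral)
    show ?thesis
      using KS_entropy_le_topological_entropy[OF \<mu> assms(1) P assms(2-5) k(1)]
    proof eventually_elim
      case (elim l)
      have "a < ennreal (h - 3 / real k)"
        using k(2) a' by (simp add: ennreal_less_iff)
      also have "\<dots> \<le> ?h l" using elim by (simp add: h_def)
      finally show ?case .
    qed
  qed
qed

end
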